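(* Let $n\ge 4$ and $t>0$, and let $h:\mathbb{R}^n\to\mathbb{R}$ be an even Schwartz function satisfying: (i) $h(x)\ge e^{-t\|x\|^2}$ for every nonzero $x$ in every unimodular integral lattice $\Lambda\subset\mathbb{R}^n$; (ii) $\widehat h(x)\le 0$ for every nonzero $x$ in every unimodular integral lattice $\Lambda\subset\mathbb{R}^n$. If $h$ is sharp at $\mathbb{Z}^n$, i.e. if $$1+\widehat h(0)-h(0)=\Theta_{\mathbb{Z}^n}(t),$$ then for every $x\in\mathbb{R}^n$ with $x\neq 0$ and $\|x\|^2\in\mathbb{Z}$, $$h(x)=e^{-t\|x\|^2}\quad\text{and}\quad \widehat h(x)=0.$$
   Context: A lattice $\Lambda\subset\mathbb{R}^n$ means a full-rank lattice. It is integral if $\langle x,y\rangle\in\mathbb{Z}$ for all $x,y\in\Lambda$, and unimodular if $\operatorname{covol}(\Lambda)=1$. The Gaussian mass of $\Lambda$ is $\Theta_\Lambda(t)=\sum_{x\in\Lambda}e^{-t\|x\|^2}$ for $t>0$. The Fourier transform is $\widehat f(\xi)=\int_{\mathbb{R}^n}f(x)e^{-2\pi i\langle x,\xi\rangle}\,dx$; for $h$ real and even, $\widehat h$ is real-valued. *)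

theory Defs
  imports "HOL-Analysis.Analysis"
begin

definition Zn :: "(real ^ 'n) set" where
  "Zn = {z. \<forall>i. z $ i \<in> \<int>}"

text \<open>The integer span of the columns of \<open>B\<close>.\<close>
definition lattice_of :: "real ^ 'n ^ 'n \<Rightarrow> (real ^ 'n) set" where
  "lattice_of B = (\<lambda>z. B *v z) ` Zn"

definition full_lattice :: "(real ^ 'n) set \<Rightarrow> bool" where
  "full_lattice L \<longleftrightarrow> (\<exists>B. invertible B \<and> L = lattice_of B)"

text \<open>The common value of \<open>\<bar>det B\<bar>\<close> over all bases of \<open>L\<close>; see \<open>covol_lattice_of\<close>
  for the independence of the basis.\<close>
definition covol :: "(real ^ 'n) set \<Rightarrow> real" where
  "covol L = (THE v. \<exists>B. invertible B \<and> L = lattice_of B \<and> v = \<bar>det B\<bar>)"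

definition integral_lattice :: "(real ^ 'n) set \<Rightarrow> bool" where
  "integral_lattice L \<longleftrightarrow> full_lattice L \<and> (\<forall>x\<in>L. \<forall>y\<in>L. x \<bullet> y \<in> \<int>)"

definition unimodular_lattice :: "(real ^ 'n) set \<Rightarrow> bool" where
  "unimodular_lattice L \<longleftrightarrow> full_lattice L \<and> covol L = 1"

definition gaussian_mass :: "(real ^ 'n) set \<Rightarrow> real \<Rightarrow> real" where
  "gaussian_mass L t = (\<Sum>\<^sub>\<infinity>x\<in>L. exp (- t * (norm x)\<^sup>2))"

definition partial_deriv ::
    "'n \<Rightarrow> (real ^ 'n \<Rightarrow> 'b::real_normed_vector) \<Rightarrow> real ^ 'n \<Rightarrow> 'b" where
  "partial_deriv i f x = frechet_derivative f (at x) (axis i 1)"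

definition iter_partial_deriv ::
    "'n list \<Rightarrow> (real ^ 'n \<Rightarrow> 'b::real_normed_vector) \<Rightarrow> real ^ 'n \<Rightarrow> 'b" where
  "iter_partial_deriv is f = fold partial_deriv is f"

text \<open>\<open>f\<close> is smooth because all of its iterated partial derivatives are differentiable, and
  lists of directions cover all multi-indices.\<close>
definition schwartz :: "(real ^ 'n \<Rightarrow> 'b::real_normed_vector) \<Rightarrow> bool" where
  "schwartz f \<longleftrightarrow>
     (\<forall>is. (\<forall>x. iter_partial_deriv is f differentiable (at x)) \<and>
           (\<forall>k::nat. bounded (range (\<lambda>x. norm x ^ k *\<^sub>R iter_partial_deriv is f x))))"

definition fourier :: "(real ^ 'n \<Rightarrow> complex) \<Rightarrow> real ^ 'n \<Rightarrow> complex" where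
  "fourier f \<xi> = (LINT x|lborel. f x * exp (- 2 * complex_of_real pi * \<i> * complex_of_real (x \<bullet> \<xi>)))"

lemma mat_1_lattice_of: "lattice_of (mat 1) = Zn"
  by (simp add: lattice_of_def)

lemma column_in_lattice_of:
  fixes B :: "real ^ 'n ^ 'n"
  shows "column j B \<in> lattice_of B"
proof -
  have "axis j 1 \<in> (Zn :: (real ^ 'n) set)"
    by (auto simp: Zn_def axis_def)
  then show ?thesis
    unfolding lattice_of_def using matrix_vector_mult_basis[of B j] by force
qed

lemma lattice_of_subsetD:
  fixes B C :: "real ^ 'n ^ 'n"
  assumes "lattice_of C \<subseteq> lattice_of B"
  obtains U where "C = B ** U" and "\<And>i j. U $ i $ j \<in> \<int>"
proof -
  have "\<exists>z\<in>Zn. column j C = B *v z" for j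
    using assms column_in_lattice_of[of j C] unfolding lattice_of_def by auto
  then obtain z where z: "\<And>j. z j \<in> Zn" "\<And>j. column j C = B *v z j"
    by metis
  define U :: "real ^ 'n ^ 'n" where "U = (\<chi> i j. z j $ i)"
  have "C $ i $ j = (B ** U) $ i $ j" for i j
  proof -
    have "C $ i $ j = (B *v z j) $ i"
      using z(2)[of j] by (metis column_def vec_lambda_beta)
    then show ?thesis
      by (simp add: matrix_matrix_mult_def matrix_vector_mult_def U_def)
  qed
  then have "C = B ** U"
    by (simp add: vec_eq_iff)
  moreover have "U $ i $ j \<in> \<int>" for i j
    using z(1)[of j] by (simp add: Zn_def U_def)
  ultimately show ?thesis
    using that by blast
qed

lemma det_in_Ints:
  fixes U :: "real ^ 'n ^ 'n"
  assumes "\<And>i j. U $ i $ j \<in> \<int>"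
  shows "det U \<in> \<int>"
  unfolding det_def by (intro Ints_sum Ints_mult Ints_prod Ints_of_int assms)

lemma covol_lattice_of:
  fixes B :: "real ^ 'n ^ 'n"
  assumes B: "invertible B"
  shows "covol (lattice_of B) = \<bar>det B\<bar>"
proof -
  have uniq: "\<bar>det C\<bar> = \<bar>det B\<bar>"
    if C: "invertible C" and eq: "lattice_of B = lattice_of C" for C :: "real ^ 'n ^ 'n"
  proof -
    obtain U where U: "C = B ** U" "\<And>i j. U $ i $ j \<in> \<int>"
      using lattice_of_subsetD[of C B] eq by auto
    obtain V where V: "B = C ** V" "\<And>i j. V $ i $ j \<in> \<int>"
      using lattice_of_subsetD[of B C] eq by auto
    have dU: "det C = det B * det U" and dV: "det B = det C * det V"
      using U(1) V(1) det_mul by metis+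
    have nz: "det B \<noteq> 0" "det C \<noteq> 0"
      using B C by (auto simp: invertible_det_nz)
    have "1 \<le> \<bar>det U\<bar>" "1 \<le> \<bar>det V\<bar>"
    proof -
      have "det U \<noteq> 0" "det V \<noteq> 0"
        using dU dV nz by (metis mult_zero_right)+
      then show "1 \<le> \<bar>det U\<bar>" "1 \<le> \<bar>det V\<bar>"
        using det_in_Ints[OF U(2)] det_in_Ints[OF V(2)] by (auto intro!: Ints_nonzero_abs_ge1)
    qed
    then have "\<bar>det B\<bar> \<le> \<bar>det B\<bar> * \<bar>det U\<bar>" "\<bar>det C\<bar> \<le> \<bar>det C\<bar> * \<bar>det V\<bar>"
      using mult_left_mono[of 1 "\<bar>det U\<bar>" "\<bar>det B\<bar>"] mult_left_mono[of 1 "\<bar>det V\<bar>" "\<bar>det C\<bar>"]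
      by auto
    moreover have "\<bar>det C\<bar> = \<bar>det B\<bar> * \<bar>det U\<bar>"
      by (subst dU) (rule abs_mult)
    moreover have "\<bar>det B\<bar> = \<bar>det C\<bar> * \<bar>det V\<bar>"
      by (subst dV) (rule abs_mult)
    ultimately have "\<bar>det B\<bar> \<le> \<bar>det C\<bar>" "\<bar>det C\<bar> \<le> \<bar>det B\<bar>"
      by linarith+
    then show ?thesis by simp
  qed
  show ?thesis
    unfolding covol_def by (rule the_equality) (use B uniq in blast)+
qed

text \<open>For an even real function, the real part of its Fourier transform is all of it.\<close>
lemma fourier_even_real:
  fixes h :: "real ^ 'n \<Rightarrow> real"
  assumes [measurable]: "h \<in> borel_measurable borel" and even: "\<And>x. h (- x) = h x"
  shows "fourier (\<lambda>x. complex_of_real (h x)) \<xi> \<in> \<real>"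
proof -
  let ?g = "\<lambda>x. complex_of_real (h x) * exp (- 2 * complex_of_real pi * \<i> * complex_of_real (x \<bullet> \<xi>))"
  have lb: "(lborel :: (real ^ 'n) measure) = distr lborel borel uminus"
    using lborel_affine[of "-1" "0 :: real ^ 'n"] by (simp add: density_1)
  have "integral\<^sup>L lborel ?g = integral\<^sup>L (distr lborel borel uminus) ?g"
    by (subst lb) simp
  also have "\<dots> = (LINT x|lborel. ?g (- x))"
    by (rule integral_distr) measurable
  also have "\<dots> = (LINT x|lborel. cnj (?g x))"
    by (intro Bochner_Integration.integral_cong refl) (simp add: even exp_cnj)
  also have "\<dots> = cnj (integral\<^sup>L lborel ?g)"
    by (rule Bochner_Integration.integral_cnj)
  finally show ?thesis
    unfolding fourier_def by (metis Reals_cnj_iff)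
qed

end

theory Submission
  imports Defs "HOL-Computational_Algebra.Primes" "HOL-Probability.Sinc_Integral"
begin

text \<open>For an orthogonal map \<open>R\<close>, the lattice \<open>R \<int>\<^sup>n\<close> is unimodular and integral. Poisson
  summation over it, together with the two sign conditions and sharpness, squeezes
  \<open>\<Theta>(t) - 1 \<le> \<Sum>\<^sub>z\<^sub>\<noteq>\<^sub>0 h(R z) \<le> \<Theta>(t) - 1 + fourier h (R k)\<close> for each nonzero integer vector \<open>k\<close>,
  so \<open>fourier h\<close> vanishes and \<open>h\<close> agrees with the Gaussian at every nonzero point of \<open>R \<int>\<^sup>n\<close>. As
  \<open>n \<ge> 4\<close>, the four-square theorem provides an integer vector of any prescribed integral squared
  norm, which some \<open>R\<close> moves to the given point.

  Only an upper bound for \<open>\<Sum>\<^sub>z h(R z)\<close> is needed, so no decay of \<open>fourier h\<close> is used: integrating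
  \<open>h \<circ> R\<close> against the Fejer kernel of order \<open>N\<close> gives on the one hand a finite sum of Fourier
  coefficients with weights in \<open>[0, 1]\<close>, in which nonpositive terms may be dropped, and on the
  other hand converges to the lattice sum as \<open>N \<rightarrow> \<infinity>\<close>.\<close>

section \<open>The four-square theorem\<close>

definition sum_of_4_squares :: "int \<Rightarrow> bool" where
  "sum_of_4_squares n \<longleftrightarrow> (\<exists>a b c d. n = a\<^sup>2 + b\<^sup>2 + c\<^sup>2 + d\<^sup>2)"

lemma four_squares_identity:
  fixes a b c d w x y z :: int
  shows "(a\<^sup>2 + b\<^sup>2 + c\<^sup>2 + d\<^sup>2) * (w\<^sup>2 + x\<^sup>2 + y\<^sup>2 + z\<^sup>2) =
    (a * w + b * x + c * y + d * z)\<^sup>2 + (a * x - b * w + c * z - d * y)\<^sup>2 +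
    (a * y - b * z - c * w + d * x)\<^sup>2 + (a * z + b * y - c * x - d * w)\<^sup>2"
  by (simp add: power2_eq_square algebra_simps)

lemma sum_of_4_squares_mult:
  assumes "sum_of_4_squares m" "sum_of_4_squares n"
  shows "sum_of_4_squares (m * n)"
  using assms four_squares_identity unfolding sum_of_4_squares_def by metis

lemma exists_small_residue:
  fixes m x :: int
  assumes "m > 0"
  obtains y where "m dvd x - y" "2 * \<bar>y\<bar> \<le> m"
proof
  \<comment> \<open>The shift by \<open>m div 2\<close> before and after the reduction centres the
    residue system around 0.\<close>
  define y where "y = (x + m div 2) mod m - m div 2"
  show "m dvd x - y"
  proof -
    have "x - y = (x + m div 2) - (x + m div 2) mod m" by (simp add: y_def)
    then show ?thesis by (simp add: minus_mod_eq_mult_div)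
  qed
  define k where "k = m div 2"
  define r where "r = (x + k) mod m"
  have "0 \<le> r" "r < m" using assms by (auto simp: r_def)
  moreover have "m \<le> 2 * k + 1" "2 * k \<le> m" unfolding k_def by linarith+
  ultimately show "2 * \<bar>y\<bar> \<le> m" unfolding y_def k_def[symmetric] r_def[symmetric] by arith
qed

text \<open>With \<open>x = y + m * k\<close> the difference of squares is
  \<open>2 * y * m * k + m\<^sup>2 * k\<^sup>2\<close>, and \<open>2 * y\<close> is \<open>m\<close>
  or \<open>- m\<close>. This excludes the extremal case of the descent, where all four residues
  have absolute value \<open>m / 2\<close>.\<close>

lemma square_dvd_diff_half:
  fixes m x y :: int
  assumes "m dvd x - y" "2 * \<bar>y\<bar> = m"
  shows "m\<^sup>2 dvd x\<^sup>2 - y\<^sup>2"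
proof -
  obtain k where k: "x = y + m * k" using assms(1) by (metis dvdE diff_eq_eq add.commute)
  have "2 * y * m = m\<^sup>2 \<or> 2 * y * m = - m\<^sup>2"
    using assms(2) by (auto simp: power2_eq_square abs_if split: if_splits)
  moreover have "x\<^sup>2 - y\<^sup>2 = (2 * y * m) * k + m\<^sup>2 * k\<^sup>2"
    unfolding k by (simp add: power2_eq_square algebra_simps)
  ultimately show ?thesis by (auto intro!: dvd_add)
qed

text \<open>Lagrange's descent. The four numbers are replaced by their least absolute residues
  modulo \<open>m\<close>, whose squares sum to \<open>S = m * r\<close>. Either extreme,
  \<open>S = 0\<close> or \<open>S = m\<^sup>2\<close>, would give that \<open>m\<^sup>2\<close>
  divides \<open>m * p\<close>, impossible for \<open>1 < m < p\<close>; hence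
  \<open>0 < r < m\<close>. In Euler's identity for \<open>(m * p) * (m * r)\<close> all four
  squared forms are divisible by \<open>m\<close>, and \<open>m\<^sup>2\<close> cancels.\<close>

lemma four_squares_descent:
  fixes m p :: int
  assumes p: "prime p" and m: "1 < m" "m < p" and mp: "sum_of_4_squares (m * p)"
  obtains r where "0 < r" "r < m" "sum_of_4_squares (r * p)"
proof -
  obtain a b c d where abcd: "m * p = a\<^sup>2 + b\<^sup>2 + c\<^sup>2 + d\<^sup>2"
    using mp unfolding sum_of_4_squares_def by blast
  obtain w where w: "m dvd a - w" "2 * \<bar>w\<bar> \<le> m" using exists_small_residue[of m a] m by auto
  obtain x where x: "m dvd b - x" "2 * \<bar>x\<bar> \<le> m" using exists_small_residue[of m b] m by auto
  obtain y where y: "m dvd c - y" "2 * \<bar>y\<bar> \<le> m" using exists_small_residue[of m c] m by auto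
  obtain z where z: "m dvd d - z" "2 * \<bar>z\<bar> \<le> m" using exists_small_residue[of m d] m by auto
  have sq_le: "4 * u\<^sup>2 \<le> m\<^sup>2" if "2 * \<bar>u\<bar> \<le> m" for u :: int
    using power_mono[OF that, of 2] by (simp add: power_mult_distrib)
  have sq_eq: "2 * \<bar>u\<bar> = m" if "4 * u\<^sup>2 = m\<^sup>2" for u :: int
  proof -
    have "(2 * \<bar>u\<bar>)\<^sup>2 = m\<^sup>2" using that by (simp add: power_mult_distrib)
    then show ?thesis using m by (subst (asm) power2_eq_iff_nonneg) auto
  qed
  define S where "S = w\<^sup>2 + x\<^sup>2 + y\<^sup>2 + z\<^sup>2"
  have not_sq: "\<not> m\<^sup>2 dvd a\<^sup>2 + b\<^sup>2 + c\<^sup>2 + d\<^sup>2"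
  proof
    assume "m\<^sup>2 dvd a\<^sup>2 + b\<^sup>2 + c\<^sup>2 + d\<^sup>2"
    then have "m * m dvd m * p" by (simp only: abcd power2_eq_square)
    then have "m dvd p" using m by simp
    then show False using p m by (auto simp: prime_int_iff dest!: spec[of _ m])
  qed
  have dvd_sq: "m dvd u\<^sup>2 - v\<^sup>2" if "m dvd u - v" for u v :: int
    using that by (simp add: power2_eq_square square_diff_square_factored)
  have "m dvd S"
  proof -
    have "m * p - S = (a\<^sup>2 - w\<^sup>2) + (b\<^sup>2 - x\<^sup>2) + (c\<^sup>2 - y\<^sup>2) + (d\<^sup>2 - z\<^sup>2)"
      by (simp add: abcd S_def)
    then have "m dvd m * p - S"
      by (simp only:) (intro dvd_add dvd_sq w x y z)
    then show ?thesis by (simp add: dvd_diff_right_iff)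
  qed
  then obtain r where r: "S = m * r" by blast
  have "S \<noteq> 0"
  proof
    assume "S = 0"
    then have "w\<^sup>2 = 0 \<and> x\<^sup>2 = 0 \<and> y\<^sup>2 = 0 \<and> z\<^sup>2 = 0"
      unfolding S_def by (smt (verit) zero_le_power2)
    then have "m dvd a" "m dvd b" "m dvd c" "m dvd d" using w x y z by auto
    then have "m\<^sup>2 dvd a\<^sup>2 + b\<^sup>2 + c\<^sup>2 + d\<^sup>2" by (intro dvd_add dvd_power_same)
    then show False using not_sq by simp
  qed
  moreover have "0 \<le> S" unfolding S_def by simp
  ultimately have "0 < m * r" using r by linarith
  then have r0: "0 < r" using m by (simp add: zero_less_mult_iff)
  have "S \<le> m\<^sup>2" 
    using sq_le[OF w(2)] sq_le[OF x(2)] sq_le[OF y(2)] sq_le[OF z(2)] unfolding S_def by linarith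
  moreover have "S \<noteq> m\<^sup>2"
  proof
    assume S: "S = m\<^sup>2"
    \<comment> \<open>Each of the four squares is at most \<open>m\<^sup>2 / 4\<close>, so a sum
      equal to \<open>m\<^sup>2\<close> forces equality in all of them.\<close>
    have "4 * w\<^sup>2 = m\<^sup>2" "4 * x\<^sup>2 = m\<^sup>2" "4 * y\<^sup>2 = m\<^sup>2" "4 * z\<^sup>2 = m\<^sup>2"
      using S sq_le[OF w(2)] sq_le[OF x(2)] sq_le[OF y(2)] sq_le[OF z(2)] unfolding S_def by linarith+
    then have "m\<^sup>2 dvd a\<^sup>2 - w\<^sup>2" "m\<^sup>2 dvd b\<^sup>2 - x\<^sup>2" "m\<^sup>2 dvd c\<^sup>2 - y\<^sup>2" "m\<^sup>2 dvd d\<^sup>2 - z\<^sup>2"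
      using sq_eq square_dvd_diff_half w x y z by blast+
    then have "m\<^sup>2 dvd (a\<^sup>2 - w\<^sup>2) + (b\<^sup>2 - x\<^sup>2) + (c\<^sup>2 - y\<^sup>2) + (d\<^sup>2 - z\<^sup>2) + S"
      unfolding S by (intro dvd_add) auto
    then show False using not_sq by (simp add: S_def algebra_simps)
  qed
  ultimately have "m * r < m * m" using r unfolding power2_eq_square by linarith
  then have rm: "r < m" using m by simp
  \<comment> \<open>Modulo \<open>m\<close> each residue may be replaced by its original, which
    turns the form into \<open>m * p\<close>.\<close>
  have e1: "m dvd a * w + b * x + c * y + d * z"
  proof -
    have "a * w + b * x + c * y + d * z =
        m * p - (a * (a - w) + b * (b - x) + c * (c - y) + d * (d - z))"
      unfolding abcd by (simp add: power2_eq_square algebra_simps)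
    also have "m dvd \<dots>" 
      by (rule dvd_diff[OF dvd_triv_left dvd_add[OF dvd_add[OF dvd_add[OF dvd_mult[OF w(1)]
        dvd_mult[OF x(1)]] dvd_mult[OF y(1)]] dvd_mult[OF z(1)]]])
    finally show ?thesis .
  qed
  \<comment> \<open>Modulo \<open>m\<close> this is \<open>u * u' - u' * u = 0\<close>. Each of the
    other three forms of Euler's identity combines two such expressions.\<close>
  have cross: "m dvd u * v' - u' * v" if "m dvd u - v" "m dvd u' - v'" for u v u' v' :: int
  proof -
    have "u * v' - u' * v = u' * (u - v) - u * (u' - v')" by (simp add: algebra_simps)
    then show ?thesis by (simp only: dvd_diff[OF dvd_mult[OF that(1)] dvd_mult[OF that(2)]])
  qed
  have e2: "m dvd a * x - b * w + c * z - d * y"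
    using dvd_add[OF cross[OF w(1) x(1)] cross[OF y(1) z(1)]] by (simp add: algebra_simps)
  have e3: "m dvd a * y - b * z - c * w + d * x"
    using dvd_diff[OF cross[OF w(1) y(1)] cross[OF x(1) z(1)]] by (simp add: algebra_simps)
  have e4: "m dvd a * z + b * y - c * x - d * w"
    using dvd_add[OF cross[OF w(1) z(1)] cross[OF x(1) y(1)]] by (simp add: algebra_simps)
  obtain A B C D where ABCD: "a * w + b * x + c * y + d * z = m * A"
      "a * x - b * w + c * z - d * y = m * B" "a * y - b * z - c * w + d * x = m * C"
      "a * z + b * y - c * x - d * w = m * D"
    using e1 e2 e3 e4 unfolding dvd_def by blast
  have "(m * p) * (m * r) = (m * A)\<^sup>2 + (m * B)\<^sup>2 + (m * C)\<^sup>2 + (m * D)\<^sup>2"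
    using four_squares_identity[of a b c d w x y z] unfolding abcd ABCD r[symmetric] S_def .
  then have "m\<^sup>2 * (r * p) = m\<^sup>2 * (A\<^sup>2 + B\<^sup>2 + C\<^sup>2 + D\<^sup>2)"
    by (simp add: power2_eq_square algebra_simps)
  then have "r * p = A\<^sup>2 + B\<^sup>2 + C\<^sup>2 + D\<^sup>2" using m by simp
  then have "sum_of_4_squares (r * p)" unfolding sum_of_4_squares_def by blast
  with r0 rm show ?thesis using that by blast
qed

text \<open>On this range both \<open>a - b\<close> and \<open>a + b\<close> are smaller than
  \<open>p\<close> in absolute value, so a multiple of \<open>p\<close> among them is 0. The
  parameters \<open>c\<close> and \<open>e\<close> let one lemma serve both the squares and the
  values of \<open>- b\<^sup>2 - 1\<close>.\<close>

lemma inj_on_square_mod_prime: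
  fixes p :: int
  assumes p: "prime p" and c: "\<not> p dvd c"
  shows "inj_on (\<lambda>a. (c * a\<^sup>2 + e) mod p) {0..(p - 1) div 2}"
proof
  fix a b assume a: "a \<in> {0..(p - 1) div 2}" and b: "b \<in> {0..(p - 1) div 2}"
    and eq: "(c * a\<^sup>2 + e) mod p = (c * b\<^sup>2 + e) mod p"
  from eq have "p dvd (c * a\<^sup>2 + e) - (c * b\<^sup>2 + e)" by (simp add: mod_eq_dvd_iff)
  also have "(c * a\<^sup>2 + e) - (c * b\<^sup>2 + e) = c * ((a - b) * (a + b))"
    by (simp add: power2_eq_square algebra_simps)
  finally have "p dvd a - b \<or> p dvd a + b" using p c by (simp add: prime_dvd_mult_iff)
  moreover have "\<bar>a - b\<bar> < p" "\<bar>a + b\<bar> < p"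
    using a b prime_gt_1_int[OF p] by auto
  ultimately have "a - b = 0 \<or> a + b = 0"
    using dvd_imp_le_int[of "a - b" p] dvd_imp_le_int[of "a + b" p] by force
  then show "a = b" using a b by auto
qed

text \<open>Pigeonhole: the residues of \<open>a\<^sup>2\<close> and of
  \<open>- b\<^sup>2 - 1\<close> form two sets of \<open>(p + 1) / 2\<close> elements each among
  \<open>p\<close> residues, so they meet. The size bound makes the first multiplier of the descent
  smaller than \<open>p\<close>.\<close>

lemma prime_dvd_two_squares_plus_one:
  fixes p :: int
  assumes p: "prime p" "odd p"
  obtains a b where "p dvd a\<^sup>2 + b\<^sup>2 + 1" "a\<^sup>2 + b\<^sup>2 + 1 < p\<^sup>2"
proof -
  have p3: "p \<ge> 3" using p prime_gt_1_int[OF p(1)] by (cases "p = 2") auto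
  let ?I = "{0..(p - 1) div 2}"
  let ?f = "\<lambda>a. (1 * a\<^sup>2 + 0) mod p" and ?g = "\<lambda>a. ((-1) * a\<^sup>2 + (-1)) mod p"
  have unit: "\<not> p dvd 1" "\<not> p dvd - 1" using p3 by auto
  have "card (?f ` ?I) = card ?I" "card (?g ` ?I) = card ?I"
    by (rule card_image[OF inj_on_square_mod_prime[OF p(1) unit(1)]],
        rule card_image[OF inj_on_square_mod_prime[OF p(1) unit(2)]])
  moreover have "2 * card ?I = nat p + 1"
    using p p3 by (auto elim!: oddE)
  moreover have "card (?f ` ?I \<union> ?g ` ?I) \<le> card {0..<p}"
    using p3 by (intro card_mono) auto
  moreover have "card {0..<p} = nat p" by simp
  moreover have "card (?f ` ?I) + card (?g ` ?I) = card (?f ` ?I \<union> ?g ` ?I) + card (?f ` ?I \<inter> ?g ` ?I)"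
    by (intro card_Un_Int) auto
  ultimately have "card (?f ` ?I \<inter> ?g ` ?I) \<noteq> 0" by linarith
  then have "?f ` ?I \<inter> ?g ` ?I \<noteq> {}" by (metis card.empty)
  then obtain a b where ab: "a \<in> ?I" "b \<in> ?I" "?f a = ?g b" by blast
  show thesis
  proof
    have "p dvd (1 * a\<^sup>2 + 0) - ((-1) * b\<^sup>2 + (-1))" using ab(3) by (simp only: mod_eq_dvd_iff)
    then show "p dvd a\<^sup>2 + b\<^sup>2 + 1" by (simp add: algebra_simps)
    have "a\<^sup>2 \<le> ((p - 1) div 2)\<^sup>2" "b\<^sup>2 \<le> ((p - 1) div 2)\<^sup>2"
      using ab by (auto intro!: power_mono)
    moreover have "4 * ((p - 1) div 2)\<^sup>2 = (p - 1)\<^sup>2"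
      using p(2) by (auto elim!: oddE simp: power_mult_distrib)
    moreover have "(p - 1)\<^sup>2 < p\<^sup>2" using p3 by (intro power_strict_mono) auto
    moreover have "3 * 3 \<le> p * p" using p3 by (intro mult_mono) auto
    ultimately show "a\<^sup>2 + b\<^sup>2 + 1 < p\<^sup>2" unfolding power2_eq_square by linarith
  qed
qed

lemma sum_of_4_squares_descend:
  fixes p :: int
  assumes p: "prime p" and "sum_of_4_squares (m * p)" "0 < m" "m < p"
  shows "sum_of_4_squares p"
  using assms(2-)
proof (induction "nat m" arbitrary: m rule: less_induct)
  case less
  show ?case
  proof (cases "m = 1")
    case False
    then obtain r where "0 < r" "r < m" "sum_of_4_squares (r * p)"
      using four_squares_descent[OF p, of m] less.prems by auto
    then show ?thesis using less by auto
  qed (use less in simp)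
qed

lemma sum_of_4_squares_prime:
  fixes p :: int
  assumes p: "prime p"
  shows "sum_of_4_squares p"
proof (cases "even p")
  case True
  then have "p = 2" by (metis p primes_dvd_imp_eq two_is_prime)
  then have "p = 1\<^sup>2 + 1\<^sup>2 + 0\<^sup>2 + 0\<^sup>2" by simp
  then show ?thesis unfolding sum_of_4_squares_def by blast
next
  case False
  then obtain a b where ab: "p dvd a\<^sup>2 + b\<^sup>2 + 1" "a\<^sup>2 + b\<^sup>2 + 1 < p\<^sup>2"
    using prime_dvd_two_squares_plus_one[OF p] by blast
  then obtain m where m: "a\<^sup>2 + b\<^sup>2 + 1 = m * p" by (metis dvdE mult.commute)
  have p0: "p > 0" using p by (simp add: prime_gt_0_int)
  have "m * p > 0" unfolding m[symmetric] by (smt (verit) zero_le_power2)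
  then have "m > 0" using p0 by (simp add: zero_less_mult_iff)
  moreover have "m < p" using ab(2) p0 unfolding m by (simp add: power2_eq_square)
  moreover have "m * p = a\<^sup>2 + b\<^sup>2 + 1\<^sup>2 + 0\<^sup>2" using m by simp
  then have "sum_of_4_squares (m * p)" unfolding sum_of_4_squares_def by blast
  ultimately show ?thesis using sum_of_4_squares_descend[OF p] by blast
qed

lemma sum_of_4_squares_nat: "sum_of_4_squares (int n)"
proof (induction n rule: less_induct)
  case (less n)
  consider "n = 0" | "n = 1" | "n > 1" by linarith
  then show ?case
  proof cases
    case 1
    then have "int n = 0\<^sup>2 + 0\<^sup>2 + 0\<^sup>2 + 0\<^sup>2" by simp
    then show ?thesis unfolding sum_of_4_squares_def by blast
  next
    case 2
    then have "int n = 1\<^sup>2 + 0\<^sup>2 + 0\<^sup>2 + 0\<^sup>2" by simp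
    then show ?thesis unfolding sum_of_4_squares_def by blast
  next
    case 3
    then obtain p where p: "prime p" "p dvd n" using prime_factor_nat[of n] by auto
    then obtain k where k: "n = p * k" by blast
    then have "k < n" using 3 prime_gt_1_nat[OF p(1)] by (cases "k = 0") auto
    then show ?thesis
      using sum_of_4_squares_mult[of "int p" "int k"] sum_of_4_squares_prime[of "int p"] less p k
      by simp
  qed
qed


section \<open>The Fejer kernel\<close>

text \<open>The kernel of period 1 as a squared modulus, which makes it visibly nonnegative; its
  Fourier coefficient at an integer \<open>d\<close> is \<open>max 0 (1 - \<bar>d\<bar> / N)\<close>
  for \<open>N > 0\<close>. At \<open>N = 0\<close> the value is 0.\<close>

definition fejer :: "nat \<Rightarrow> real \<Rightarrow> real" where
  "fejer N x = (cmod (\<Sum>j<N. cis (2 * pi * real j * x)))\<^sup>2 / real N"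

lemma fejer_nonneg: "0 \<le> fejer N x"
  by (simp add: fejer_def)

lemma continuous_on_fejer: "continuous_on UNIV (fejer N)"
  unfolding fejer_def cis_conv_exp divide_inverse by (intro continuous_intros)

lemma borel_measurable_fejer [measurable]: "fejer N \<in> borel_measurable borel"
  by (rule borel_measurable_continuous_onI[OF continuous_on_fejer])

lemma fejer_periodic:
  assumes "k \<in> \<int>"
  shows "fejer N (x + k) = fejer N x"
proof -
  have "cis (2 * pi * real j * (x + k)) = cis (2 * pi * real j * x)" for j
  proof -
    have "cis (2 * pi * real j * (x + k)) = cis (2 * pi * real j * x) * cis (2 * pi * (real j * k))"
      by (simp add: cis_mult algebra_simps)
    moreover have "cis (2 * pi * (real j * k)) = 1"
      using assms by (intro cis_multiple_2pi) simp
    ultimately show ?thesis by simp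
  qed
  then show ?thesis by (simp only: fejer_def)
qed

lemma cmod_sum_squared:
  fixes z :: "'a \<Rightarrow> complex"
  shows "(cmod (\<Sum>j\<in>A. z j))\<^sup>2 = (\<Sum>j\<in>A. \<Sum>l\<in>A. Re (z j * cnj (z l)))"
proof -
  have "(cmod (\<Sum>j\<in>A. z j))\<^sup>2 = Re ((\<Sum>j\<in>A. z j) * cnj (\<Sum>j\<in>A. z j))"
    by (metis Re_complex_of_real complex_norm_square)
  then show ?thesis by (simp add: sum_product Re_sum)
qed

lemma Re_cis_mult_cnj_cis: "Re (cis a * cnj (cis b)) = cos (a - b)"
  by (simp add: cos_diff)

lemma fejer_eq_sum_cos:
  "fejer N x = (\<Sum>j<N. \<Sum>l<N. cos (2 * pi * (real j - real l) * x)) / real N"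
  unfolding fejer_def cmod_sum_squared Re_cis_mult_cnj_cis by (simp add: algebra_simps)

lemma has_integral_cos_period:
  fixes m :: int
  shows "((\<lambda>x. cos (2 * pi * of_int m * x)) has_integral (if m = 0 then 1 else 0)) {-(1/2)..1/2::real}"
proof (cases "m = 0")
  case True
  then show ?thesis using has_integral_const_real[of "1::real" "-(1/2)" "1/2"] by simp
next
  case False
  define c where "c = 2 * pi * of_int m"
  have c: "c \<noteq> 0" using False by (simp add: c_def)
  have "((\<lambda>x. cos (c * x)) has_integral sin (c * (1/2)) / c - sin (c * (-(1/2))) / c) {-(1/2)..1/2}"
    using c by (intro fundamental_theorem_of_calculus)
      (auto intro!: derivative_eq_intros simp: has_real_derivative_iff_has_vector_derivative[symmetric])
  moreover have "sin (c * (1/2)) = 0"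
    unfolding c_def by (simp add: sin_zero_iff_int2)
  ultimately show ?thesis using False by (simp add: c_def)
qed

text \<open>Of the \<open>N\<^sup>2\<close> cosines only the \<open>N\<close> diagonal ones have
  nonzero mean, and each contributes 1.\<close>

lemma nn_integral_fejer_period:
  assumes "N > 0"
  shows "(\<integral>\<^sup>+x. ennreal (indicator {-(1/2)..<1/2} x * fejer N x) \<partial>lborel) = 1"
proof -
  have "((\<lambda>x. (\<Sum>j<N. \<Sum>l<N. cos (2 * pi * of_int (int j - int l) * x)) / real N) has_integral
      (\<Sum>j<N. \<Sum>l<N. if int j - int l = 0 then 1 else 0) / real N) {-(1/2)..1/2}"
    by (intro has_integral_divide has_integral_sum has_integral_cos_period) auto
  moreover have "(\<Sum>j<N. \<Sum>l<N. if int j - int l = 0 then 1 else (0::real)) = real N"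
    by simp
  ultimately have "(fejer N has_integral 1) {-(1/2)..1/2}"
    using assms by (simp add: fejer_eq_sum_cos[abs_def])
  then have "(\<integral>\<^sup>+x. ennreal (fejer N x) * indicator {-(1/2)..1/2} x \<partial>lborel) = 1"
    using nn_integral_has_integral_lebesgue'[of "{-(1/2)..1/2}" "fejer N" 1] by (simp add: fejer_nonneg)
  \<comment> \<open>The half-open interval, which will tile the line, differs from the closed one by
    the null set \<open>{1/2}\<close>.\<close>
  moreover have "(\<integral>\<^sup>+x. ennreal (indicator {-(1/2)..<1/2} x * fejer N x) \<partial>lborel) =
      (\<integral>\<^sup>+x. ennreal (fejer N x) * indicator {-(1/2)..1/2} x \<partial>lborel)"
    by (intro nn_integral_cong_AE, use AE_lborel_singleton[of "1/2::real"] in eventually_elim)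
       (auto simp: indicator_def)
  ultimately show ?thesis by simp
qed

text \<open>The exponential sum is geometric with ratio \<open>z\<close>, hence at most
  \<open>2 / cmod (1 - z)\<close> in modulus, and
  \<open>cmod (1 - z) = 2 * \<bar>sin (pi * x)\<bar>\<close>. So the mass concentrates at the origin
  as \<open>N\<close> grows.\<close>

lemma fejer_le_off_origin:
  assumes "0 < \<delta>" "\<delta> \<le> \<bar>x\<bar>" "\<bar>x\<bar> \<le> 1/2"
  shows "fejer N x \<le> 1 / (real N * (sin (pi * \<delta>))\<^sup>2)"
proof (cases "N = 0")
  case False
  define z where "z = cis (2 * pi * x)"
  have s: "0 < sin (pi * \<delta>)" using assms by (intro sin_gt_zero) (auto simp: field_simps)
  have "sin (pi * \<delta>) \<le> sin (pi * \<bar>x\<bar>)"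
    using assms mult_left_mono[of "\<bar>x\<bar>" "1/2" pi] mult_left_mono[of \<delta> "\<bar>x\<bar>" pi]
      mult_nonneg_nonneg[of pi \<delta>] pi_gt_zero
    by (intro sin_monotone_2pi_le) linarith+
  then have sx: "sin (pi * \<delta>) \<le> \<bar>sin (pi * x)\<bar>" using s by (cases "0 \<le> x") auto
  have "(cmod (1 - z))\<^sup>2 = (2 * sin (pi * x))\<^sup>2"
  proof -
    have "(cmod (1 - z))\<^sup>2 = (1 - cos (2 * (pi * x)))\<^sup>2 + (sin (2 * (pi * x)))\<^sup>2"
      by (simp add: z_def cmod_def mult.assoc)
    also have "\<dots> = 2 - 2 * cos (2 * (pi * x))"
      by (simp add: sin_squared_eq power2_eq_square algebra_simps)
    also have "\<dots> = (2 * sin (pi * x))\<^sup>2"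
      by (simp add: cos_double_sin power_mult_distrib)
    finally show ?thesis .
  qed
  then have "(2 * sin (pi * \<delta>))\<^sup>2 \<le> (cmod (1 - z))\<^sup>2"
    using s sx by (simp add: power_mult_distrib abs_le_square_iff[symmetric])
  then have z1: "2 * sin (pi * \<delta>) \<le> cmod (1 - z)" by (rule power2_le_imp_le) simp
  then have z: "z \<noteq> 1" using s by auto
  have "(\<Sum>j<N. cis (2 * pi * real j * x)) = (\<Sum>j<N. z ^ j)"
    by (intro sum.cong refl) (simp only: z_def Complex.DeMoivre mult_ac)
  also have "\<dots> = (1 - z ^ N) / (1 - z)" using z by (simp add: sum_gp_strict)
  finally have "cmod (\<Sum>j<N. cis (2 * pi * real j * x)) = cmod (1 - z ^ N) / cmod (1 - z)"
    by (simp add: norm_divide)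
  also have "\<dots> \<le> 2 / (2 * sin (pi * \<delta>))"
  proof (rule frac_le)
    show "cmod (1 - z ^ N) \<le> 2"
      using norm_triangle_ineq4[of 1 "z ^ N"] by (simp add: z_def norm_power)
  qed (use z1 s in auto)
  finally have "(cmod (\<Sum>j<N. cis (2 * pi * real j * x)))\<^sup>2 \<le> (1 / sin (pi * \<delta>))\<^sup>2"
    by (intro power_mono) auto
  then show ?thesis using False
    by (simp add: fejer_def power_divide divide_right_mono field_simps)
qed (simp add: fejer_def)

section \<open>The product Fejer kernel as an approximate identity on the unit cell\<close>

lemma nn_integral_prod_vec:
  fixes f :: "'n::finite \<Rightarrow> real \<Rightarrow> ennreal"
  assumes "\<And>i. f i \<in> borel_measurable borel"
  shows "(\<integral>\<^sup>+x. (\<Prod>i\<in>UNIV. f i ((x::real^'n) $ i)) \<partial>lborel) = (\<Prod>i\<in>UNIV. \<integral>\<^sup>+x. f i x \<partial>lborel)"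
proof -
  \<comment> \<open>Tonelli's theorem for \<open>lborel\<close> is indexed by \<open>Basis\<close>;
    \<open>a\<close> is the bijection from coordinate indices to basis vectors.\<close>
  define a :: "'n \<Rightarrow> real^'n" where "a = (\<lambda>i. axis i 1)"
  have B: "(Basis :: (real^'n) set) = range a" by (auto simp: a_def Basis_vec_def)
  have inj: "inj a" by (auto simp: a_def inj_def axis_eq_axis)
  have "(\<integral>\<^sup>+x. (\<Prod>b\<in>(Basis::(real^'n) set). f (inv a b) (x \<bullet> b)) \<partial>lborel) =
      (\<Prod>b\<in>(Basis::(real^'n) set). \<integral>\<^sup>+x. f (inv a b) x \<partial>lborel)"
    by (intro nn_integral_lborel_prod assms) auto
  then show ?thesis
    unfolding B by (simp add: prod.reindex[OF inj] inj inv_f_f) (simp add: a_def inner_axis)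
qed

definition fejer_vec :: "nat \<Rightarrow> real^'n \<Rightarrow> real" where
  "fejer_vec N x = (\<Prod>i\<in>UNIV. fejer N (x $ i))"

text \<open>Half-open so that its integer translates partition the space, and centred so that the
  concentration point 0 of the kernel is interior.\<close>

definition unit_cell :: "(real^'n) set" where
  "unit_cell = {x. \<forall>i. x $ i \<in> {-(1/2)..<1/2}}"

lemma fejer_vec_nonneg: "0 \<le> fejer_vec N x"
  by (simp add: fejer_vec_def prod_nonneg fejer_nonneg)

lemma continuous_on_fejer_vec: "continuous_on UNIV (fejer_vec N)"
  unfolding fejer_vec_def
  by (intro continuous_intros continuous_on_compose2[OF continuous_on_fejer]) auto

lemma borel_measurable_fejer_vec [measurable]: "fejer_vec N \<in> borel_measurable borel"
  by (rule borel_measurable_continuous_onI[OF continuous_on_fejer_vec])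

lemma fejer_vec_periodic: "k \<in> Zn \<Longrightarrow> fejer_vec N (x + k) = fejer_vec N x"
  by (simp add: fejer_vec_def Zn_def fejer_periodic)

lemma unit_cell_measurable [measurable]: "(unit_cell :: (real^'n) set) \<in> sets borel"
proof -
  have "unit_cell = (\<Inter>i. {x::real^'n. -(1/2) \<le> x $ i} \<inter> {x. x $ i < 1/2})"
    by (auto simp: unit_cell_def)
  also have "\<dots> \<in> sets borel"
    by (intro sets.finite_INT sets.Int borel_closed borel_open closed_halfspace_component_ge_cart
        open_halfspace_component_lt_cart) auto
  finally show ?thesis .
qed

lemma prod_indicator_cell:
  fixes x :: "real^'n"
  shows "(\<Prod>i\<in>UNIV. indicator (S i) (x $ i)) = (indicator {x. \<forall>i. x $ i \<in> S i} x :: real)"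
  by (auto simp: indicator_def prod_eq_1_iff prod_zero_iff)

lemma nn_integral_fejer_vec_box:
  fixes S :: "'n::finite \<Rightarrow> real set"
  assumes "\<And>i. S i \<in> sets borel"
  shows "(\<integral>\<^sup>+x. ennreal (indicator {x::real^'n. \<forall>i. x $ i \<in> S i} x * fejer_vec N x) \<partial>lborel) =
    (\<Prod>i\<in>UNIV. \<integral>\<^sup>+x. ennreal (indicator (S i) x * fejer N x) \<partial>lborel)"
proof -
  have [measurable]: "S i \<in> sets borel" for i by fact
  have "(\<integral>\<^sup>+x. ennreal (indicator {x::real^'n. \<forall>i. x $ i \<in> S i} x * fejer_vec N x) \<partial>lborel) =
    (\<integral>\<^sup>+x. (\<Prod>i\<in>UNIV. ennreal (indicator (S i) ((x::real^'n) $ i) * fejer N (x $ i))) \<partial>lborel)"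
    by (simp add: prod_ennreal fejer_nonneg prod.distrib prod_indicator_cell fejer_vec_def)
  also have "\<dots> = (\<Prod>i\<in>UNIV. \<integral>\<^sup>+x. ennreal (indicator (S i) x * fejer N x) \<partial>lborel)"
    by (rule nn_integral_prod_vec[where f = "\<lambda>i x. ennreal (indicator (S i) x * fejer N x)"]) measurable
  finally show ?thesis .
qed

lemma has_bochner_integral_fejer_vec_cell:
  assumes "N > 0"
  shows "has_bochner_integral lborel (\<lambda>x::real^'n. indicator unit_cell x * fejer_vec N x) 1"
proof (rule has_bochner_integral_nn_integral)
  show "(\<integral>\<^sup>+x. ennreal (indicator unit_cell (x::real^'n) * fejer_vec N x) \<partial>lborel) = ennreal 1"
    unfolding unit_cell_def
    by (subst nn_integral_fejer_vec_box) (auto simp: nn_integral_fejer_period[OF assms])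
qed (auto simp: fejer_vec_nonneg)

text \<open>The integral factorises: the factor in coordinate \<open>i\<close> is bounded by the
  off-origin estimate on an interval of length at most 1, and every other factor is 1.\<close>

lemma nn_integral_fejer_vec_slab:
  fixes i :: "'n::finite"
  assumes N: "N > 0" and \<delta>: "0 < \<delta>"
  shows "(\<integral>\<^sup>+x. ennreal (indicator (unit_cell \<inter> {x::real^'n. \<delta> \<le> \<bar>x $ i\<bar>}) x * fejer_vec N x) \<partial>lborel)
    \<le> ennreal (1 / (real N * (sin (pi * \<delta>))\<^sup>2))"
proof -
  define c where "c = 1 / (real N * (sin (pi * \<delta>))\<^sup>2)"
  define S where "S j = (if j = i then {-(1/2)..<1/2} \<inter> {x. \<delta> \<le> \<bar>x\<bar>} else {-(1/2)..<1/2::real})" for j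
  have c0: "0 \<le> c" by (simp add: c_def)
  have S[measurable]: "S j \<in> sets borel" for j by (simp add: S_def)
  have eq: "unit_cell \<inter> {x. \<delta> \<le> \<bar>x $ i\<bar>} = {x::real^'n. \<forall>j. x $ j \<in> S j}"
    by (auto simp: unit_cell_def S_def split: if_splits)
  have "(\<integral>\<^sup>+x. ennreal (indicator (S i) x * fejer N x) \<partial>lborel) \<le>
      (\<integral>\<^sup>+x. ennreal c * indicator {-(1/2)..1/2} (x::real) \<partial>lborel)"
  proof (rule nn_integral_mono)
    fix x :: real
    show "ennreal (indicator (S i) x * fejer N x) \<le> ennreal c * indicator {-(1/2)..1/2} x"
    proof (cases "x \<in> S i")
      case True
      then have "fejer N x \<le> c" "x \<in> {-(1/2)..1/2}"
        unfolding c_def using \<delta> by (auto simp: S_def intro!: fejer_le_off_origin)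
      then show ?thesis using True by (auto intro: ennreal_leI)
    qed simp
  qed
  also have "\<dots> = ennreal c" by (simp add: nn_integral_cmult)
  finally have i: "(\<integral>\<^sup>+x. ennreal (indicator (S i) x * fejer N x) \<partial>lborel) \<le> ennreal c" .
  have "(\<Prod>j\<in>UNIV. \<integral>\<^sup>+x. ennreal (indicator (S j) x * fejer N x) \<partial>lborel) =
      (\<integral>\<^sup>+x. ennreal (indicator (S i) x * fejer N x) \<partial>lborel) *
      (\<Prod>j\<in>UNIV - {i}. \<integral>\<^sup>+x. ennreal (indicator (S j) x * fejer N x) \<partial>lborel)"
    by (rule prod.remove) auto
  also have "(\<Prod>j\<in>UNIV - {i}. \<integral>\<^sup>+x. ennreal (indicator (S j) x * fejer N x) \<partial>lborel) = 1"
    by (intro prod.neutral) (auto simp: S_def nn_integral_fejer_period[OF N])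
  finally show ?thesis
    unfolding eq nn_integral_fejer_vec_box[OF S] c_def[symmetric] using i by simp
qed

text \<open>The kernel has mass 1 on the cell, so \<open>g\<close> is compared with the constant
  \<open>g 0\<close>. Near 0 continuity controls the difference; the rest of the cell is covered by
  one slab per coordinate, each of mass \<open>O(1 / N)\<close>.\<close>

lemma fejer_approximate_identity:
  fixes g :: "real^'n \<Rightarrow> real"
  assumes [measurable]: "g \<in> borel_measurable borel" and g: "\<And>x. x \<in> unit_cell \<Longrightarrow> \<bar>g x\<bar> \<le> B"
    and cont: "isCont g 0"
  shows "(\<lambda>N. LINT x|lborel. indicator unit_cell x * (g x * fejer_vec N x)) \<longlonglongrightarrow> g 0"
proof (rule LIMSEQ_I)
  fix e :: real assume e: "0 < e"
  obtain d where d: "0 < d" "\<And>x. norm x < d \<Longrightarrow> \<bar>g x - g 0\<bar> < e / 2"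
    using cont e unfolding continuous_at_eps_delta dist_norm
    by (metis diff_zero half_gt_zero real_norm_def)
  \<comment> \<open>The second bound puts the cube of half-width \<open>\<delta>\<close> into the
    ball of radius \<open>d\<close>, by the l1 estimate of the norm; the first keeps
    \<open>sin (pi * \<delta>)\<close> positive.\<close>
  define \<delta> where "\<delta> = min (1/2) (d / real CARD('n))"
  have \<delta>: "0 < \<delta>" "\<delta> \<le> 1/2" "real CARD('n) * \<delta> \<le> d"
    using d by (auto simp: \<delta>_def min_def field_simps)
  have near: "\<bar>g x - g 0\<bar> < e / 2" if "\<And>i. \<bar>x $ i\<bar> < \<delta>" for x
  proof (rule d)
    have "norm x \<le> (\<Sum>i\<in>UNIV. \<bar>x $ i\<bar>)" by (rule norm_le_l1_cart)
    also have "\<dots> < (\<Sum>i\<in>(UNIV::'n set). \<delta>)" using that by (intro sum_strict_mono) auto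
    finally show "norm x < d" using \<delta> by simp
  qed
  define s where "s = (sin (pi * \<delta>))\<^sup>2"
  have "0 < sin (pi * \<delta>)" using \<delta> by (intro sin_gt_zero) (auto simp: field_simps)
  then have s: "0 < s" by (simp add: s_def)
  have "(0::real^'n) \<in> unit_cell" by (simp add: unit_cell_def)
  then have B: "\<bar>g 0\<bar> \<le> B" "0 \<le> B" using g[of 0] by auto
  define T where "T i = unit_cell \<inter> {x::real^'n. \<delta> \<le> \<bar>x $ i\<bar>}" for i
  have T[measurable]: "T i \<in> sets borel" for i
    unfolding T_def by measurable
  \<comment> \<open>Beyond this \<open>M\<close> the slabs together contribute less than
    \<open>e / 2\<close>.\<close>
  obtain M :: nat where M: "real CARD('n) * (2 * B) / s / (e / 2) < real M"
    using reals_Archimedean2 by blast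
  show "\<exists>no. \<forall>N\<ge>no. norm ((LINT x|lborel. indicator unit_cell x * (g x * fejer_vec N x)) - g 0) < e"
  proof (intro exI allI impI)
    fix N assume "N \<ge> max 1 M"
    then have N: "N > 0" "real M \<le> real N" by auto
    have Ki: "integrable lborel (\<lambda>x::real^'n. indicator unit_cell x * fejer_vec N x)"
      and K: "(LINT x|lborel. indicator unit_cell x * fejer_vec N (x::real^'n)) = 1"
      using has_bochner_integral_fejer_vec_cell[OF N(1)] by (auto simp: has_bochner_integral_iff)
    have slab: "integrable lborel (\<lambda>x::real^'n. indicator (T i) x * fejer_vec N x)"
      "(LINT x|lborel. indicator (T i) x * fejer_vec N x) \<le> 1 / (real N * s)" for i
    proof -
      have le: "(\<integral>\<^sup>+x. ennreal (indicator (T i) x * fejer_vec N x) \<partial>lborel) \<le> ennreal (1 / (real N * s))"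
        unfolding T_def s_def by (rule nn_integral_fejer_vec_slab[OF N(1) \<delta>(1)])
      show I: "integrable lborel (\<lambda>x::real^'n. indicator (T i) x * fejer_vec N x)"
        using le by (intro integrableI_nonneg)
          (auto simp: fejer_vec_nonneg intro: le_less_trans)
      show "(LINT x|lborel. indicator (T i) x * fejer_vec N x) \<le> 1 / (real N * s)"
        using le s by (subst (asm) nn_integral_eq_integral[OF I]) (auto simp: fejer_vec_nonneg)
    qed
    have gK: "integrable lborel (\<lambda>x. indicator unit_cell x * (g x * fejer_vec N x))"
    proof (rule Bochner_Integration.integrable_bound)
      show "integrable lborel (\<lambda>x::real^'n. B * (indicator unit_cell x * fejer_vec N x))"
        using Ki by auto
      show "AE x in lborel. norm (indicator unit_cell x * (g x * fejer_vec N x)) \<le>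
          norm (B * (indicator unit_cell x * fejer_vec N x))"
        using g B by (intro AE_I2) (auto simp: indicator_def abs_mult fejer_vec_nonneg intro!: mult_right_mono)
    qed simp
    have "\<bar>(LINT x|lborel. indicator unit_cell x * (g x * fejer_vec N x)) - g 0\<bar> =
      \<bar>(LINT x|lborel. indicator unit_cell x * (g x * fejer_vec N x)) -
        (LINT x|lborel. g 0 * (indicator unit_cell x * fejer_vec N (x::real^'n)))\<bar>"
      using K by simp
    also have "\<dots> = \<bar>LINT x|lborel. indicator unit_cell x * (g x * fejer_vec N x) -
        g 0 * (indicator unit_cell x * fejer_vec N x)\<bar>"
      using gK Ki by (subst Bochner_Integration.integral_diff) auto
    \<comment> \<open>The integrand is bounded pointwise by \<open>e / 2\<close> times the kernel
      where all coordinates are below \<open>\<delta>\<close>, and by \<open>2 * B\<close> times the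
      kernel on at least one slab elsewhere.\<close>
    also have "\<dots> \<le> (LINT x|lborel. (e / 2) * (indicator unit_cell x * fejer_vec N x) +
        (\<Sum>i\<in>UNIV. (2 * B) * (indicator (T i) x * fejer_vec N x)))"
    proof (rule integral_abs_bound_integral)
      show "integrable lborel (\<lambda>x. indicator unit_cell x * (g x * fejer_vec N x) -
          g 0 * (indicator unit_cell x * fejer_vec N x))"
        using gK Ki by auto
      show "integrable lborel (\<lambda>x. (e / 2) * (indicator unit_cell x * fejer_vec N x) +
          (\<Sum>i\<in>UNIV. (2 * B) * (indicator (T i) x * fejer_vec N x)))"
        using Ki slab by auto
      fix x :: "real^'n"
      have nn: "0 \<le> (\<Sum>i\<in>UNIV. (2 * B) * (indicator (T i) x * fejer_vec N x))"
        using B by (intro sum_nonneg) (auto simp: fejer_vec_nonneg)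
      show "\<bar>indicator unit_cell x * (g x * fejer_vec N x) - g 0 * (indicator unit_cell x * fejer_vec N x)\<bar>
          \<le> (e / 2) * (indicator unit_cell x * fejer_vec N x) +
            (\<Sum>i\<in>UNIV. (2 * B) * (indicator (T i) x * fejer_vec N x))"
      proof (cases "x \<in> unit_cell")
        case x: True
        have eq: "\<bar>indicator unit_cell x * (g x * fejer_vec N x) - g 0 * (indicator unit_cell x * fejer_vec N x)\<bar>
            = \<bar>g x - g 0\<bar> * fejer_vec N x"
          using x by (simp add: left_diff_distrib[symmetric] abs_mult fejer_vec_nonneg)
        show ?thesis
        proof (cases "\<forall>i. \<bar>x $ i\<bar> < \<delta>")
          case True
          then have "\<bar>g x - g 0\<bar> * fejer_vec N x \<le> (e / 2) * fejer_vec N x"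
            using near[of x] by (intro mult_right_mono) (auto simp: fejer_vec_nonneg)
          then show ?thesis unfolding eq using x nn by simp
        next
          case False
          then obtain i where i: "x \<in> T i" using x by (auto simp: T_def not_less)
          have "\<bar>g x - g 0\<bar> * fejer_vec N x \<le> (2 * B) * fejer_vec N x"
            using g[OF x] B by (intro mult_right_mono) (auto simp: fejer_vec_nonneg)
          also have "\<dots> = (2 * B) * (indicator (T i) x * fejer_vec N x)" using i by simp
          also have "\<dots> \<le> (\<Sum>i\<in>UNIV. (2 * B) * (indicator (T i) x * fejer_vec N x))"
            using B by (intro member_le_sum) (auto simp: fejer_vec_nonneg)
          finally show ?thesis unfolding eq using e x by (simp add: fejer_vec_nonneg add_increasing)
        qed
      next
        case False
        then show ?thesis using nn by simp
      qed
    qed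
    also have "\<dots> = (e / 2) * (LINT x|lborel. indicator unit_cell x * fejer_vec N (x::real^'n)) +
        (\<Sum>i\<in>UNIV. (2 * B) * (LINT x|lborel. indicator (T i) x * fejer_vec N x))"
      using Ki slab by (subst Bochner_Integration.integral_add) auto
    also have "\<dots> \<le> e / 2 + (\<Sum>i\<in>(UNIV::'n set). (2 * B) * (1 / (real N * s)))"
      using slab(2) B K by (intro add_mono sum_mono mult_left_mono) auto
    also have "\<dots> = e / 2 + real CARD('n) * (2 * B) / s / real N" by simp
    also have "\<dots> < e / 2 + e / 2"
    proof -
      have "real CARD('n) * (2 * B) / s / (e / 2) < real N" using M N by linarith
      then show ?thesis using e N s by (simp add: field_simps)
    qed
    finally show "norm ((LINT x|lborel. indicator unit_cell x * (g x * fejer_vec N x)) - g 0) < e" by simp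
  qed
qed


section \<open>Poisson summation\<close>

text \<open>A majorant in product form, so that its integral factorises into integrals over the
  line; it changes only by a bounded factor under shifts within a cell.\<close>

definition cauchy_weight :: "real^'n \<Rightarrow> real" where
  "cauchy_weight x = (\<Prod>i\<in>UNIV. 1 / (1 + (x $ i)\<^sup>2))"

lemma one_plus_square_pos: "0 < 1 + (x::real)\<^sup>2"
  by (simp add: add_pos_nonneg)

lemma cauchy_weight_pos: "0 < cauchy_weight x"
  unfolding cauchy_weight_def by (intro prod_pos) (simp add: one_plus_square_pos)

lemma borel_measurable_cauchy_weight [measurable]: "cauchy_weight \<in> borel_measurable borel"
proof (rule borel_measurable_continuous_onI)
  show "continuous_on UNIV (cauchy_weight :: real^'n \<Rightarrow> real)"
    unfolding cauchy_weight_def using one_plus_square_pos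
    by (intro continuous_intros ballI) (metis less_irrefl)
qed

lemma integrable_cauchy_weight: "integrable lborel (cauchy_weight :: real^'n \<Rightarrow> real)"
proof (rule integrableI_nonneg)
  have 1: "integrable lborel (\<lambda>x::real. 1 / (1 + x\<^sup>2))"
    using integrable_inverse_1_plus_square by (simp add: set_integrable_def divide_inverse)
  have "(\<integral>\<^sup>+x. ennreal (cauchy_weight (x::real^'n)) \<partial>lborel) =
      (\<integral>\<^sup>+x. (\<Prod>i\<in>UNIV. ennreal (1 / (1 + ((x::real^'n) $ i)\<^sup>2))) \<partial>lborel)"
    by (simp add: cauchy_weight_def prod_ennreal one_plus_square_pos less_imp_le)
  also have "\<dots> = (\<Prod>i\<in>(UNIV::'n set). \<integral>\<^sup>+x. ennreal (1 / (1 + x\<^sup>2)) \<partial>lborel)"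
    by (rule nn_integral_prod_vec[where f = "\<lambda>i x. ennreal (1 / (1 + x\<^sup>2))"]) measurable
  also have "\<dots> < \<infinity>"
    using integrableD(2)[OF 1] by (simp add: power_less_top_ennreal less_top)
  finally show "(\<integral>\<^sup>+x. ennreal (cauchy_weight (x::real^'n)) \<partial>lborel) < \<infinity>" .
qed (auto simp: less_imp_le[OF cauchy_weight_pos])

lemma cauchy_weight_le_shift:
  fixes x y :: "real^'n"
  assumes "\<And>i. \<bar>x $ i\<bar> \<le> 1/2"
  shows "cauchy_weight (y + x) \<le> 2 ^ CARD('n) * cauchy_weight y"
proof -
  have "1 / (1 + ((y + x) $ i)\<^sup>2) \<le> 2 * (1 / (1 + (y $ i)\<^sup>2))" for i
  proof -
    define a b where "a = y $ i" and "b = x $ i"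
    have "b\<^sup>2 \<le> (1/2)\<^sup>2" using assms[of i] by (simp add: b_def abs_le_square_iff[symmetric])
    \<comment> \<open>The difference of the two sides is \<open>(a + 2 * b)\<^sup>2\<close>.\<close>
    moreover have "a\<^sup>2 + 0 \<le> 2 * (a + b)\<^sup>2 + 2 * b\<^sup>2"
      using zero_le_power2[of "a + 2 * b"] by (simp add: power2_eq_square algebra_simps)
    ultimately have "1 + a\<^sup>2 \<le> 2 * (1 + (a + b)\<^sup>2)" by (simp add: power2_eq_square)
    then show ?thesis
      using one_plus_square_pos[of a] one_plus_square_pos[of "a + b"]
      by (simp add: a_def[symmetric] b_def[symmetric] divide_simps)
  qed
  then have "cauchy_weight (y + x) \<le> (\<Prod>i\<in>UNIV. 2 * (1 / (1 + (y $ i)\<^sup>2)))"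
    unfolding cauchy_weight_def
    by (intro prod_mono) (auto simp: less_imp_le[OF one_plus_square_pos])
  also have "\<dots> = 2 ^ CARD('n) * cauchy_weight y"
    unfolding prod.distrib cauchy_weight_def by simp
  finally show ?thesis .
qed

lemma unit_cell_abs_le: "x \<in> unit_cell \<Longrightarrow> \<bar>x $ i\<bar> \<le> 1/2"
  unfolding unit_cell_def by (auto simp: abs_le_iff intro: less_imp_le dest!: spec[of _ i])

lemma Zn_eq_range: "(Zn :: (real^'n) set) = range (\<lambda>f. \<chi> i. of_int (f i))"
proof -
  have "z \<in> range (\<lambda>f. \<chi> i. of_int (f i))" if "z \<in> Zn" for z :: "real^'n"
  proof
    show "z = (\<chi> i. of_int \<lfloor>z $ i\<rfloor>)" using that by (auto simp: Zn_def vec_eq_iff elim: Ints_cases)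
  qed simp
  then show ?thesis by (auto simp: Zn_def)
qed

lemma countable_Zn: "countable (Zn :: (real^'n) set)"
  unfolding Zn_eq_range by simp

lemma infinite_Zn: "infinite (Zn :: (real^'n) set)"
proof -
  have "inj (\<lambda>m::nat. vec (real m) :: real^'n)" by (auto simp: inj_def vec_eq_iff)
  moreover have "range (\<lambda>m::nat. vec (real m) :: real^'n) \<subseteq> Zn" by (auto simp: Zn_def)
  ultimately show ?thesis by (meson finite_subset range_inj_infinite)
qed

definition cell_at :: "real^'n \<Rightarrow> (real^'n) set" where
  "cell_at k = {x. x - k \<in> unit_cell}"

lemma cell_at_measurable [measurable]: "cell_at k \<in> sets borel"
proof -
  have "cell_at k = (\<lambda>x. x - k) -` unit_cell \<inter> space borel" by (simp add: cell_at_def vimage_def)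
  also have "\<dots> \<in> sets borel" by (rule measurable_sets[OF _ unit_cell_measurable]) measurable
  finally show ?thesis .
qed

lemma cell_at_disjoint:
  assumes "k \<in> Zn" "l \<in> Zn" "k \<noteq> l"
  shows "cell_at k \<inter> cell_at l = {}"
proof (rule ccontr)
  assume "cell_at k \<inter> cell_at l \<noteq> {}"
  then obtain x where x: "x - k \<in> unit_cell" "x - l \<in> unit_cell" by (auto simp: cell_at_def)
  have "k $ i = l $ i" for i
  proof -
    have "-(1/2) \<le> x $ i - k $ i" "x $ i - k $ i < 1/2" "-(1/2) \<le> x $ i - l $ i" "x $ i - l $ i < 1/2"
      using x by (auto simp: unit_cell_def)
    then have "\<bar>k $ i - l $ i\<bar> < 1" by linarith
    moreover have "k $ i - l $ i \<in> \<int>" using assms by (auto simp: Zn_def)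
    ultimately show ?thesis using Ints_nonzero_abs_less1 by fastforce
  qed
  then show False using assms by (simp add: vec_eq_iff)
qed

lemma Union_cell_at: "(\<Union>k\<in>Zn. cell_at k) = (UNIV :: (real^'n) set)"
proof -
  have "x \<in> (\<Union>k\<in>Zn. cell_at k)" for x :: "real^'n"
  proof
    \<comment> \<open>Rounding to the nearest integer, with ties upwards to match the half-open
      cell.\<close>
    show "(\<chi> i. of_int \<lfloor>x $ i + 1/2\<rfloor>) \<in> (Zn :: (real^'n) set)" by (simp add: Zn_def)
    have "-(1/2) \<le> x $ i - of_int \<lfloor>x $ i + 1/2\<rfloor> \<and> x $ i - of_int \<lfloor>x $ i + 1/2\<rfloor> < 1/2" for i
      by linarith
    then show "x \<in> cell_at (\<chi> i. of_int \<lfloor>x $ i + 1/2\<rfloor>)"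
      by (simp add: cell_at_def unit_cell_def)
  qed
  then show ?thesis by auto
qed

lemma integral_lborel_shift:
  fixes f :: "real^'n \<Rightarrow> real"
  assumes "f \<in> borel_measurable borel"
  shows "(LINT x|lborel. f (x + k)) = (LINT x|lborel. f x)"
  using integral_distr[of "(+) k" lborel borel f] assms
  by (simp add: lborel_distr_plus add.commute)

lemma integral_cell_at:
  fixes f :: "real^'n \<Rightarrow> real"
  assumes [measurable]: "f \<in> borel_measurable borel"
  shows "(LINT x:cell_at k|lborel. f x) = (LINT x|lborel. indicator unit_cell x * f (x + k))"
proof -
  have "(LINT x:cell_at k|lborel. f x) = (LINT x|lborel. indicator (cell_at k) (x + k) * f (x + k))"
    unfolding set_lebesgue_integral_def real_scaleR_def
    by (rule integral_lborel_shift[symmetric]) measurable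
  then show ?thesis by (simp add: cell_at_def indicator_def)
qed

text \<open>An integral test: up to the factor \<open>2 ^ CARD('n)\<close> each value is bounded by
  the integral over the cell around the point, and the cells are disjoint, so the total integral
  bounds all partial sums.\<close>

lemma summable_cauchy_weight:
  fixes e :: "nat \<Rightarrow> real^'n"
  assumes e: "bij_betw e UNIV Zn"
  shows "summable (\<lambda>m. cauchy_weight (e m))"
proof (rule summableI_nonneg_bounded)
  let ?W = "\<lambda>A. LINT x:A|lborel. cauchy_weight (x::real^'n)"
  have eZ: "e m \<in> Zn" for m using e by (auto simp: bij_betw_def)
  have int: "set_integrable lborel A (cauchy_weight::real^'n \<Rightarrow> real)" if "A \<in> sets borel" for A
    using integrable_mult_indicator[OF _ integrable_cauchy_weight] that by (simp add: set_integrable_def)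
  have cell: "cauchy_weight (e m) \<le> 2 ^ CARD('n) * ?W (cell_at (e m))" for m
  proof -
    \<comment> \<open>The Fejer kernel of order 1 is constantly 1, so its mass is the volume of the
      cell. Integrability follows because a non-integrable function would have integral 0.\<close>
    have 1: "(LINT x|lborel. indicator unit_cell (x::real^'n)) = (1::real)"
      using has_bochner_integral_fejer_vec_cell[of 1, where 'n='n]
      by (simp add: has_bochner_integral_iff fejer_vec_def fejer_def)
    then have 2: "integrable lborel (indicator unit_cell :: real^'n \<Rightarrow> real)"
      using not_integrable_integral_eq by fastforce
    have "cauchy_weight (e m) = (LINT x|lborel. indicator unit_cell (x::real^'n) * cauchy_weight (e m))"
      using 1 by simp
    also have "\<dots> \<le> (LINT x|lborel. 2 ^ CARD('n) * (indicator unit_cell x * cauchy_weight (x + e m)))"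
    proof (rule integral_mono)
      show "integrable lborel (\<lambda>x::real^'n. indicator unit_cell x * cauchy_weight (e m))" using 2 by simp
      have "integrable lborel (\<lambda>x. cauchy_weight (e m + x))"
        using integrable_distr_eq[of "(+) (e m)" lborel borel cauchy_weight] integrable_cauchy_weight[where 'n='n]
        by (simp add: lborel_distr_plus)
      then have "integrable lborel (\<lambda>x. indicator unit_cell x *\<^sub>R cauchy_weight (e m + x))"
        by (intro integrable_mult_indicator) auto
      then show "integrable lborel (\<lambda>x. 2 ^ CARD('n) * (indicator unit_cell x * cauchy_weight (x + e m)))"
        by (simp add: add.commute)
      fix x :: "real^'n"
      have "cauchy_weight (e m) \<le> 2 ^ CARD('n) * cauchy_weight (x + e m)" if "x \<in> unit_cell"
        using cauchy_weight_le_shift[of "- x" "x + e m"] unit_cell_abs_le[OF that] by simp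
      then show "indicator unit_cell x * cauchy_weight (e m) \<le>
          2 ^ CARD('n) * (indicator unit_cell x * cauchy_weight (x + e m))"
        by (auto simp: indicator_def)
    qed
    also have "\<dots> = 2 ^ CARD('n) * ?W (cell_at (e m))"
      by (simp add: integral_cell_at)
    finally show ?thesis .
  qed
  show "(\<Sum>m<M. cauchy_weight (e m)) \<le> 2 ^ CARD('n) * (LINT x|lborel. cauchy_weight (x::real^'n))" for M
  proof -
    have "(\<Sum>m<M. ?W (cell_at (e m))) = ?W (\<Union>m\<in>{..<M}. cell_at (e m))"
    proof (rule set_integral_finite_Union[symmetric])
      show "disjoint_family_on (\<lambda>m. cell_at (e m)) {..<M}"
        using e eZ cell_at_disjoint by (fastforce simp: disjoint_family_on_def bij_betw_def inj_def)
    qed (auto intro: int)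
    also have "\<dots> \<le> (LINT x|lborel. cauchy_weight (x::real^'n))"
      unfolding set_lebesgue_integral_def
    proof (rule integral_mono)
      show "integrable lborel (\<lambda>x. indicator (\<Union>m\<in>{..<M}. cell_at (e m)) x *\<^sub>R cauchy_weight x)"
        by (intro integrable_mult_indicator integrable_cauchy_weight) auto
    qed (auto simp: integrable_cauchy_weight indicator_def less_imp_le[OF cauchy_weight_pos])
    finally have le: "(\<Sum>m<M. ?W (cell_at (e m))) \<le> (LINT x|lborel. cauchy_weight (x::real^'n))" .
    have "(\<Sum>m<M. cauchy_weight (e m)) \<le> (\<Sum>m<M. 2 ^ CARD('n) * ?W (cell_at (e m)))"
      by (intro sum_mono cell)
    also have "\<dots> = 2 ^ CARD('n) * (\<Sum>m<M. ?W (cell_at (e m)))" by (rule sum_distrib_left[symmetric])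
    also have "\<dots> \<le> 2 ^ CARD('n) * (LINT x|lborel. cauchy_weight (x::real^'n))"
      using le by (intro mult_left_mono) auto
    finally show ?thesis .
  qed
qed (simp add: less_imp_le[OF cauchy_weight_pos])

lemma fejer_le: "fejer N x \<le> real N"
proof -
  have "cmod (\<Sum>j<N. cis (2 * pi * real j * x)) \<le> real N"
    using norm_sum[of "\<lambda>j. cis (2 * pi * real j * x)" "{..<N}"] by simp
  then have "(cmod (\<Sum>j<N. cis (2 * pi * real j * x)))\<^sup>2 \<le> (real N)\<^sup>2"
    by (intro power_mono) auto
  then show ?thesis by (cases "N = 0") (auto simp: fejer_def power2_eq_square field_simps)
qed

lemma fejer_vec_le: "fejer_vec N (x::real^'n) \<le> real N ^ CARD('n)"
  unfolding fejer_vec_def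
  using prod_mono[of UNIV "\<lambda>i. fejer N (x $ i)" "\<lambda>_. real N"] by (simp add: fejer_le fejer_nonneg)

text \<open>Collects what the summation takes from \<open>h \<circ> R\<close>: continuity for the
  limit at each lattice point, and domination for integrability and for a summable majorant over the
  cells.\<close>

locale dominated_function =
  fixes f :: "real^'n \<Rightarrow> real" and C :: real
  assumes continuous: "continuous_on UNIV f"
    and dominated: "\<And>x. \<bar>f x\<bar> \<le> C * cauchy_weight x"
begin

lemma C_nonneg: "0 \<le> C"
proof -
  have "0 \<le> C * cauchy_weight (0::real^'n)" using dominated[of 0] by linarith
  then show ?thesis using cauchy_weight_pos[of "0::real^'n"] by (simp add: zero_le_mult_iff)
qed

lemma measurable_f [measurable]: "f \<in> borel_measurable borel"
  by (rule borel_measurable_continuous_onI[OF continuous])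

lemma integrable_mult_bounded:
  assumes [measurable]: "b \<in> borel_measurable borel" and b: "\<And>x. \<bar>b x\<bar> \<le> B"
  shows "integrable lborel (\<lambda>x. f x * b x)"
proof (rule Bochner_Integration.integrable_bound)
  show "integrable lborel (\<lambda>x::real^'n. (C * cauchy_weight x) * B)"
    using integrable_cauchy_weight[where 'n='n] by simp
  show "AE x in lborel. norm (f x * b x) \<le> norm (C * cauchy_weight x * B)"
  proof (rule AE_I2)
    fix x
    have "\<bar>f x\<bar> * \<bar>b x\<bar> \<le> (C * cauchy_weight x) * B"
      using b[of x] dominated[of x] by (intro mult_mono) auto
    also have "\<dots> \<le> \<bar>C * cauchy_weight x * B\<bar>" by (rule abs_ge_self)
    finally show "norm (f x * b x) \<le> norm (C * cauchy_weight x * B)"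
      by (simp only: abs_mult[symmetric] real_norm_def)
  qed
qed measurable

lemma integrable_f: "integrable lborel f"
  using integrable_mult_bounded[of "\<lambda>_. 1" 1] by simp

lemma cell_bound: "k \<in> Zn \<Longrightarrow> x \<in> unit_cell \<Longrightarrow> \<bar>f (x + k)\<bar> \<le> C * (2 ^ CARD('n) * cauchy_weight k)"
  using dominated[of "x + k"] cauchy_weight_le_shift[of x k] unit_cell_abs_le[of x]
    mult_left_mono[OF _ C_nonneg] by (metis add.commute order.trans)

text \<open>The space is cut into integer translates of the cell, and periodicity of the kernel
  moves every piece back to the cell at 0.\<close>

lemma integral_fejer_eq_suminf:
  assumes e: "bij_betw e UNIV Zn"
  shows "(LINT x|lborel. f x * fejer_vec N x) =
    (\<Sum>m. LINT x|lborel. indicator unit_cell x * (f (x + e m) * fejer_vec N x))"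
proof -
  have eZ: "e m \<in> Zn" for m using e by (auto simp: bij_betw_def)
  have U: "(\<Union>m. cell_at (e m)) = UNIV"
    using Union_cell_at bij_betw_imp_surj_on[OF e] by (metis image_image)
  have int: "integrable lborel (\<lambda>x. f x * fejer_vec N x)"
    by (rule integrable_mult_bounded[of _ "real N ^ CARD('n)"]) (auto simp: fejer_vec_nonneg fejer_vec_le)
  have "(LINT x|lborel. f x * fejer_vec N x) = (LINT x:(\<Union>m. cell_at (e m))|lborel. f x * fejer_vec N x)"
    unfolding U set_lebesgue_integral_def by simp
  also have "\<dots> = (\<Sum>m. LINT x:cell_at (e m)|lborel. f x * fejer_vec N x)"
  proof (rule lebesgue_integral_countable_add)
    show "set_integrable lborel (\<Union>m. cell_at (e m)) (\<lambda>x. f x * fejer_vec N x)"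
      unfolding U set_integrable_def using int by simp
    show "cell_at (e i) \<inter> cell_at (e j) = {}" if "i \<noteq> j" for i j
      using that e by (intro cell_at_disjoint eZ) (auto simp: bij_betw_def inj_def)
  qed simp
  also have "\<dots> = (\<Sum>m. LINT x|lborel. indicator unit_cell x * (f (x + e m) * fejer_vec N x))"
    by (simp add: integral_cell_at fejer_vec_periodic eZ)
  finally show ?thesis .
qed

text \<open>Tannery's theorem: the piece belonging to a lattice point tends to the value of
  \<open>f\<close> there, and since the kernel has mass 1 it is bounded, uniformly in
  \<open>N\<close>, by the summable \<open>M\<close>. The index \<open>Suc N\<close> avoids order 0,
  where the kernel vanishes.\<close>

lemma fejer_summation:
  shows "f summable_on Zn"
    and "(\<lambda>N. LINT x|lborel. f x * fejer_vec (Suc N) x) \<longlonglongrightarrow> (\<Sum>\<^sub>\<infinity>k\<in>Zn. f k)"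
proof -
  define e where "e = from_nat_into (Zn :: (real^'n) set)"
  have e: "bij_betw e UNIV Zn"
    unfolding e_def by (intro bij_betw_from_nat_into countable_Zn infinite_Zn)
  then have eZ: "e m \<in> Zn" for m by (auto simp: bij_betw_def)
  define a where "a m N = (LINT x|lborel. indicator unit_cell x * (f (x + e m) * fejer_vec (Suc N) x))" for m N
  define M where "M m = C * (2 ^ CARD('n) * cauchy_weight (e m))" for m
  have cont: "isCont (\<lambda>x. f (x + k)) 0" for k
  proof -
    have "continuous_on UNIV (\<lambda>x. f (x + k))"
      by (rule continuous_on_compose2[OF continuous]) (auto intro!: continuous_intros)
    then show ?thesis by (simp add: continuous_on_eq_continuous_at)
  qed
  have lim: "a m \<longlonglongrightarrow> f (e m)" for m
  proof -
    have "(\<lambda>N. LINT x|lborel. indicator unit_cell x * (f (x + e m) * fejer_vec N x)) \<longlonglongrightarrow> f (0 + e m)"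
      by (rule fejer_approximate_identity[where B = "M m"])
        (auto simp: M_def cell_bound eZ intro: cont)
    then show ?thesis unfolding a_def by (subst filterlim_sequentially_Suc) simp
  qed
  have bound: "norm (a m N) \<le> M m" for m N
  proof -
    have K: "has_bochner_integral lborel (\<lambda>x::real^'n. indicator unit_cell x * fejer_vec (Suc N) x) 1"
      by (rule has_bochner_integral_fejer_vec_cell) simp
    have "norm (a m N) \<le> (LINT x|lborel. M m * (indicator unit_cell x * fejer_vec (Suc N) (x::real^'n)))"
      unfolding a_def real_norm_def
    proof (rule integral_abs_bound_integral)
      show i: "integrable lborel (\<lambda>x::real^'n. M m * (indicator unit_cell x * fejer_vec (Suc N) x))"
        using K by (auto simp: has_bochner_integral_iff)
      show le: "\<bar>indicator unit_cell x * (f (x + e m) * fejer_vec (Suc N) x)\<bar> \<le>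
          M m * (indicator unit_cell x * fejer_vec (Suc N) x)" for x
        using cell_bound[OF eZ, of x m] unfolding M_def
        by (auto simp: indicator_def abs_mult fejer_vec_nonneg intro!: mult_right_mono)
      show "integrable lborel (\<lambda>x. indicator unit_cell x * (f (x + e m) * fejer_vec (Suc N) x))"
        by (rule Bochner_Integration.integrable_bound[OF i]) (measurable, auto intro: order.trans[OF le abs_ge_self])
    qed
    also have "\<dots> = M m" using K by (simp add: has_bochner_integral_iff)
    finally show ?thesis .
  qed
  have "summable M"
    unfolding M_def by (intro summable_mult summable_cauchy_weight e)
  then have T: "summable (\<lambda>m. norm (f (e m)))" "(\<lambda>N. \<Sum>m. a m N) \<longlonglongrightarrow> (\<Sum>m. f (e m))"
    using tannerys_theorem[of a "\<lambda>m. f (e m)" sequentially M] lim bound by (auto simp: always_eventually)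
  have "((\<lambda>m. f (e m)) has_sum (\<Sum>m. f (e m))) UNIV"
    by (intro norm_summable_imp_has_sum T summable_sums summable_norm_cancel[OF T(1)])
  then have hs: "(f has_sum (\<Sum>m. f (e m))) Zn"
    by (simp only: has_sum_reindex_bij_betw[OF e, of f])
  then show "f summable_on Zn" by (rule has_sum_imp_summable)
  show "(\<lambda>N. LINT x|lborel. f x * fejer_vec (Suc N) x) \<longlonglongrightarrow> (\<Sum>\<^sub>\<infinity>k\<in>Zn. f k)"
    unfolding infsumI[OF hs] integral_fejer_eq_suminf[OF e] using T(2) unfolding a_def .
qed

end


section \<open>The Fourier side of the Fejer integrals\<close>

definition nat_vec :: "('n \<Rightarrow> nat) \<Rightarrow> real^'n" where
  "nat_vec g = (\<chi> i. real (g i))"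

abbreviation nat_box :: "nat \<Rightarrow> ('n::finite \<Rightarrow> nat) set" where
  "nat_box N \<equiv> PiE UNIV (\<lambda>_. {..<N})"

lemma inj_nat_vec: "inj nat_vec"
  by (auto simp: inj_def nat_vec_def vec_eq_iff fun_eq_iff)

lemma nat_vec_diff_Zn: "nat_vec g - nat_vec l \<in> Zn"
  by (simp add: nat_vec_def Zn_def)

lemma prod_cis: "finite I \<Longrightarrow> (\<Prod>i\<in>I. cis (a i)) = cis (\<Sum>i\<in>I. a i)"
  by (simp add: cis_conv_exp exp_sum sum_distrib_left)

text \<open>Multiplying out the product over coordinates gives a single exponential sum with
  frequencies in the box; its squared modulus runs over pairs of indices and involves only the
  differences of their frequencies.\<close>

lemma fejer_vec_eq_sum_cos:
  fixes x :: "real^'n"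
  shows "fejer_vec N x = (\<Sum>g\<in>nat_box N. \<Sum>l\<in>nat_box N.
    cos (2 * pi * (x \<bullet> (nat_vec g - nat_vec l)))) / real N ^ CARD('n)"
proof -
  have "(\<Prod>i\<in>UNIV. \<Sum>j<N. cis (2 * pi * real j * x $ i)) =
      (\<Sum>g\<in>nat_box N. \<Prod>i\<in>UNIV. cis (2 * pi * real (g i) * x $ i))"
    by (rule prod_sum_PiE) auto
  also have "\<dots> = (\<Sum>g\<in>nat_box N. cis (2 * pi * (x \<bullet> nat_vec g)))"
    by (simp add: prod_cis inner_vec_def nat_vec_def sum_distrib_left mult_ac)
  finally have "(\<Prod>i\<in>UNIV. cmod (\<Sum>j<N. cis (2 * pi * real j * x $ i))) =
      cmod (\<Sum>g\<in>nat_box N. cis (2 * pi * (x \<bullet> nat_vec g)))"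
    by (simp only: prod_norm)
  then have "fejer_vec N x = (cmod (\<Sum>g\<in>nat_box N. cis (2 * pi * (x \<bullet> nat_vec g))))\<^sup>2 / real N ^ CARD('n)"
    by (simp add: fejer_vec_def fejer_def prod_dividef prod_power_distrib[symmetric])
  then show ?thesis
    unfolding cmod_sum_squared Re_cis_mult_cnj_cis by (simp add: inner_diff_right algebra_simps)
qed

context dominated_function
begin

lemma Re_fourier:
  "Re (fourier (\<lambda>x. complex_of_real (f x)) \<xi>) = (LINT x|lborel. f x * cos (2 * pi * (x \<bullet> \<xi>)))"
proof -
  let ?g = "\<lambda>x. complex_of_real (f x) * exp (- 2 * complex_of_real pi * \<i> * complex_of_real (x \<bullet> \<xi>))"
  have eq: "exp (- 2 * complex_of_real pi * \<i> * complex_of_real t) = cis (- (2 * pi * t))" for t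
    by (simp add: cis_conv_exp mult_ac)
  have "integrable lborel ?g"
  proof (rule Bochner_Integration.integrable_bound[OF integrable_f])
    show "?g \<in> borel_measurable lborel" by measurable
  qed (unfold eq, simp add: norm_mult)
  then have "Re (fourier (\<lambda>x. complex_of_real (f x)) \<xi>) = (LINT x|lborel. Re (?g x))"
    unfolding fourier_def by (rule integral_Re[symmetric])
  then show ?thesis unfolding eq by simp
qed

lemma integral_fejer_eq_fourier_sum:
  "(LINT x|lborel. f x * fejer_vec N x) =
    (\<Sum>g\<in>nat_box N. \<Sum>l\<in>nat_box N. Re (fourier (\<lambda>x. complex_of_real (f x)) (nat_vec g - nat_vec l)))
      / real N ^ CARD('n)"
proof -
  have int: "integrable lborel (\<lambda>x. f x * cos (2 * pi * (x \<bullet> \<xi>)))" for \<xi>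
    by (rule integrable_mult_bounded[of _ 1]) auto
  have "(LINT x|lborel. f x * fejer_vec N x) =
      (LINT x|lborel. (\<Sum>g\<in>nat_box N. \<Sum>l\<in>nat_box N. f x * cos (2 * pi * (x \<bullet> (nat_vec g - nat_vec l))))
        / real N ^ CARD('n))"
    by (simp add: fejer_vec_eq_sum_cos sum_distrib_left)
  also have "\<dots> = (\<Sum>g\<in>nat_box N. \<Sum>l\<in>nat_box N. LINT x|lborel. f x * cos (2 * pi * (x \<bullet> (nat_vec g - nat_vec l))))
        / real N ^ CARD('n)"
    using int by (simp add: Bochner_Integration.integral_sum)
  finally show ?thesis by (simp only: Re_fourier)
qed

text \<open>The nonpositive terms of frequency other than \<open>0\<close> and \<open>k\<close> are dropped; of those of
  frequency \<open>k\<close>, the \<open>(N - 2 m)^n\<close> pairs of indices at distance at least \<open>m\<close> from the boundary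
  of the box are kept.\<close>
lemma fejer_upper_bound:
  fixes k :: "real^'n"
  assumes neg: "\<And>z. z \<in> Zn \<Longrightarrow> z \<noteq> 0 \<Longrightarrow> Re (fourier (\<lambda>x. complex_of_real (f x)) z) \<le> 0"
    and k: "k \<in> Zn" "k \<noteq> 0" and m: "\<And>i. \<bar>k $ i\<bar> \<le> real m" and N: "2 * m < N"
  shows "(LINT x|lborel. f x * fejer_vec N x) \<le> Re (fourier (\<lambda>x. complex_of_real (f x)) 0) +
    ((real N - 2 * real m) / real N) ^ CARD('n) * Re (fourier (\<lambda>x. complex_of_real (f x)) k)"
proof -
  define F where "F z = Re (fourier (\<lambda>x. complex_of_real (f x)) z)" for z
  let ?J = "nat_box N :: ('n \<Rightarrow> nat) set"
  define J' where "J' = (PiE UNIV (\<lambda>_. {m..<N - m}) :: ('n \<Rightarrow> nat) set)"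
  have fin: "finite ?J" by (intro finite_PiE) auto
  have J': "J' \<subseteq> ?J" unfolding J'_def by (intro PiE_mono) auto
  have Fk: "F k \<le> 0" using neg k by (simp add: F_def)
  have cardJ: "card ?J = N ^ CARD('n)" "card J' = (N - 2 * m) ^ CARD('n)"
    by (simp_all add: card_PiE J'_def mult_2)
  \<comment> \<open>The index paired with \<open>l\<close> at frequency \<open>k\<close>. For
    \<open>l\<close> in \<open>J'\<close> the bound \<open>m\<close> on the coordinates of
    \<open>k\<close> keeps it inside the box, and nonnegative before \<open>nat\<close> is
    applied.\<close>
  define sh where "sh l = (\<lambda>i. nat \<lfloor>real (l i) + k $ i\<rfloor>)" for l :: "'n \<Rightarrow> nat"
  have sh: "sh l \<in> ?J" "nat_vec (sh l) - nat_vec l = k" if l: "l \<in> J'" for l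
  proof -
    have r: "real (sh l i) = real (l i) + k $ i" "sh l i < N" for i
    proof -
      obtain z where z: "k $ i = of_int z" using k(1) by (auto simp: Zn_def elim: Ints_cases)
      have "m \<le> l i" "l i < N - m" using l by (auto simp: J'_def PiE_def)
      moreover have "\<bar>z\<bar> \<le> int m" using m[of i] unfolding z by linarith
      ultimately show "real (sh l i) = real (l i) + k $ i" "sh l i < N"
        unfolding sh_def z using N by auto
    qed
    show "sh l \<in> ?J" using r(2) by auto
    show "nat_vec (sh l) - nat_vec l = k" by (simp add: nat_vec_def vec_eq_iff r(1))
  qed
  have zero: "(\<Sum>g\<in>?J. \<Sum>l\<in>?J. if g = l then F 0 else 0) = real N ^ CARD('n) * F 0"
    using fin by (simp add: cardJ)
  have freq: "(\<Sum>g\<in>?J. \<Sum>l\<in>?J. if nat_vec g - nat_vec l = k then F k else 0) \<le>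
      real (N - 2 * m) ^ CARD('n) * F k"
  proof -
    have "(\<Sum>g\<in>?J. \<Sum>l\<in>?J. if nat_vec g - nat_vec l = k then F k else 0) =
        (\<Sum>l\<in>?J. \<Sum>g\<in>?J. if nat_vec g - nat_vec l = k then F k else 0)" by (rule sum.swap)
    also have "\<dots> \<le> (\<Sum>l\<in>?J. if l \<in> J' then F k else 0)"
    proof (rule sum_mono)
      fix l
      show "(\<Sum>g\<in>?J. if nat_vec g - nat_vec l = k then F k else 0) \<le> (if l \<in> J' then F k else 0)"
      proof (cases "l \<in> J'")
        case True
        \<comment> \<open>Since \<open>F k \<le> 0\<close>, keeping only the pair with
          \<open>g = sh l\<close> can only enlarge the sum.\<close>
        have "(\<Sum>g\<in>?J. if nat_vec g - nat_vec l = k then F k else 0) \<le>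
            (\<Sum>g\<in>?J. if g = sh l then F k else 0)"
          using sh(2)[OF True] Fk by (intro sum_mono) auto
        then show ?thesis using True sh(1)[OF True] fin by simp
      next
        case False
        then show ?thesis using Fk by (auto intro: sum_nonpos)
      qed
    qed
    also have "\<dots> = real (card J') * F k"
      using fin by (simp add: sum.If_cases Int_absorb1[OF J'])
    finally show ?thesis by (simp add: cardJ)
  qed
  have "(\<Sum>g\<in>?J. \<Sum>l\<in>?J. F (nat_vec g - nat_vec l)) \<le>
      (\<Sum>g\<in>?J. \<Sum>l\<in>?J. (if g = l then F 0 else 0) + (if nat_vec g - nat_vec l = k then F k else 0))"
  proof (intro sum_mono)
    fix g l :: "'n \<Rightarrow> nat"
    show "F (nat_vec g - nat_vec l) \<le>
        (if g = l then F 0 else 0) + (if nat_vec g - nat_vec l = k then F k else 0)"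
      \<comment> \<open>The diagonal is kept exactly, as \<open>F 0\<close> has no prescribed sign;
        by injectivity of \<open>nat_vec\<close> it is the whole of frequency 0.\<close>
      using k(2) neg[of "nat_vec g - nat_vec l"] nat_vec_diff_Zn[of g l] injD[OF inj_nat_vec, of g l]
      by (auto simp: F_def)
  qed
  also have "\<dots> \<le> real N ^ CARD('n) * F 0 + real (N - 2 * m) ^ CARD('n) * F k"
    using zero freq by (simp add: sum.distrib)
  finally have "(LINT x|lborel. f x * fejer_vec N x) \<le>
      (real N ^ CARD('n) * F 0 + real (N - 2 * m) ^ CARD('n) * F k) / real N ^ CARD('n)"
    unfolding integral_fejer_eq_fourier_sum F_def[symmetric] by (intro divide_right_mono) auto
  also have "\<dots> = F 0 + ((real N - 2 * real m) / real N) ^ CARD('n) * F k"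
    using N by (simp add: add_divide_distrib power_divide of_nat_diff)
  finally show ?thesis by (simp add: F_def)
qed

text \<open>The limit \<open>N \<rightarrow> \<infinity>\<close> of the Fejer bound: with
  \<open>m\<close> fixed by \<open>k\<close>, the weight of frequency \<open>k\<close> tends to 1.
  Retaining one nonzero \<open>k\<close> is what later forces the transform to vanish there.\<close>

lemma infsum_le_fourier:
  fixes k :: "real^'n"
  assumes neg: "\<And>z. z \<in> Zn \<Longrightarrow> z \<noteq> 0 \<Longrightarrow> Re (fourier (\<lambda>x. complex_of_real (f x)) z) \<le> 0"
    and k: "k \<in> Zn" "k \<noteq> 0"
  shows "(\<Sum>\<^sub>\<infinity>z\<in>Zn. f z) \<le> Re (fourier (\<lambda>x. complex_of_real (f x)) 0) +
    Re (fourier (\<lambda>x. complex_of_real (f x)) k)"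
proof -
  define F where "F z = Re (fourier (\<lambda>x. complex_of_real (f x)) z)" for z
  obtain m :: nat where m: "norm k \<le> real m" using real_arch_simple by blast
  have mi: "\<bar>k $ i\<bar> \<le> real m" for i using component_le_norm_cart[of k i] m by linarith
  have "(\<lambda>N. (real (Suc N) - 2 * real m) / real (Suc N)) \<longlonglongrightarrow> 1"
  proof -
    have "(\<lambda>N. 1 - 2 * real m * inverse (real (Suc N))) \<longlonglongrightarrow> 1 - 2 * real m * 0"
      by (intro tendsto_intros LIMSEQ_inverse_real_of_nat)
    moreover have "(real (Suc N) - 2 * real m) / real (Suc N) = 1 - 2 * real m * inverse (real (Suc N))" for N
      by (simp add: field_simps)
    ultimately show ?thesis by simp
  qed
  then have "(\<lambda>N. F 0 + ((real (Suc N) - 2 * real m) / real (Suc N)) ^ CARD('n) * F k) \<longlonglongrightarrow>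
      F 0 + 1 ^ CARD('n) * F k"
    by (intro tendsto_intros)
  then have "(\<Sum>\<^sub>\<infinity>z\<in>Zn. f z) \<le> F 0 + 1 ^ CARD('n) * F k"
  proof (rule LIMSEQ_le[OF fejer_summation(2)])
    show "\<exists>M. \<forall>N\<ge>M. (LINT x|lborel. f x * fejer_vec (Suc N) x) \<le>
        F 0 + ((real (Suc N) - 2 * real m) / real (Suc N)) ^ CARD('n) * F k"
    proof (intro exI allI impI)
      fix N assume "2 * m \<le> N"
      then show "(LINT x|lborel. f x * fejer_vec (Suc N) x) \<le>
          F 0 + ((real (Suc N) - 2 * real m) / real (Suc N)) ^ CARD('n) * F k"
        unfolding F_def by (intro fejer_upper_bound[OF neg k mi]) auto
    qed
  qed
  then show ?thesis by (simp add: F_def)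
qed

end


section \<open>Orthogonal invariance\<close>

lemma borel_measurable_orthogonal:
  fixes f :: "'a::euclidean_space \<Rightarrow> 'a"
  assumes "orthogonal_transformation f"
  shows "f \<in> borel_measurable borel"
  using orthogonal_transformation_linear[OF assms]
  by (intro borel_measurable_continuous_onI linear_continuous_on) (simp add: linear_conv_bounded_linear)

lemma nn_integral_lborel_shift:
  fixes u :: "'a::euclidean_space \<Rightarrow> ennreal"
  assumes "u \<in> borel_measurable borel"
  shows "(\<integral>\<^sup>+x. u (x + c) \<partial>lborel) = (\<integral>\<^sup>+x. u x \<partial>lborel)"
proof -
  have "(\<integral>\<^sup>+x. u x \<partial>lborel) = (\<integral>\<^sup>+x. u x \<partial>distr lborel borel ((+) c))"
    by (simp only: lborel_distr_plus)
  also have "\<dots> = (\<integral>\<^sup>+x. u (c + x) \<partial>lborel)"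
    by (rule nn_integral_distr) (use assms in auto)
  finally show ?thesis by (simp add: add.commute)
qed

text \<open>The uniqueness argument for Haar measure: with \<open>A\<close> the unit ball, the double integral of
  \<open>1_A(x) 1_B(f y + x)\<close> is evaluated in both orders of integration, using translation
  invariance and \<open>f(A) = A\<close>.\<close>
lemma lborel_distr_orthogonal:
  fixes f :: "'a::euclidean_space \<Rightarrow> 'a"
  assumes f: "orthogonal_transformation f"
  shows "distr lborel borel f = lborel"
proof (rule measure_eqI)
  note f_meas [measurable] = borel_measurable_orthogonal[OF f]
  fix B :: "'a set" assume "B \<in> sets (distr lborel borel f)"
  then have [measurable]: "B \<in> sets borel" by simp
  define g where "g = inv f"
  have fg: "f (g x) = x" for x
    unfolding g_def using orthogonal_transformation_surj[OF f] by (rule surj_f_inv_f)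
  have lin: "linear f" by (rule orthogonal_transformation_linear[OF f])
  define A where "A = ball (0::'a) 1"
  have [measurable]: "A \<in> sets borel" by (simp add: A_def)
  have ball: "(\<integral>\<^sup>+y. indicator A (x - f y) \<partial>lborel) = emeasure lborel A" for x
  proof -
    \<comment> \<open>As \<open>f\<close> is an isometry, the condition on \<open>y\<close>
      describes the unit ball around \<open>g x\<close>, whose volume does not depend on the
      centre.\<close>
    have "norm (f y - x) = norm (g x - y)" for y
      using orthogonal_transformation_norm[OF f, of "g x - y"]
      by (simp add: linear_diff[OF lin] fg norm_minus_commute)
    then have "indicator A (x - f y) = (indicator (ball (g x) 1) y :: ennreal)" for y
      by (simp add: A_def indicator_def dist_norm)
    then have "(\<integral>\<^sup>+y. indicator A (x - f y) \<partial>lborel) = emeasure lborel (ball (g x) 1)" by simp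
    then show ?thesis by (simp add: A_def emeasure_ball)
  qed
  have "emeasure lborel A * emeasure lborel (f -` B) =
      (\<integral>\<^sup>+x. indicator A x * (\<integral>\<^sup>+y. indicator B (f y) \<partial>lborel) \<partial>lborel)"
  proof -
    have "(\<integral>\<^sup>+y. indicator B (f y) \<partial>lborel) = (\<integral>\<^sup>+y. indicator (f -` B) y \<partial>lborel)"
      by (simp add: indicator_def)
    also have "\<dots> = emeasure lborel (f -` B)"
      using measurable_sets[OF f_meas, of B] by (intro nn_integral_indicator) simp
    finally show ?thesis by (simp add: nn_integral_multc)
  qed
  also have "\<dots> = (\<integral>\<^sup>+x. (\<integral>\<^sup>+y. indicator A x * indicator B (f y + x) \<partial>lborel) \<partial>lborel)"
  proof (rule nn_integral_cong)
    fix x :: 'a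
    \<comment> \<open>Translating \<open>y\<close> by \<open>g x\<close> translates
      \<open>f y\<close> by \<open>x\<close>.\<close>
    have "(\<integral>\<^sup>+y. indicator B (f y) \<partial>lborel) = (\<integral>\<^sup>+y. indicator B (f (y + g x)) \<partial>lborel)"
      by (rule nn_integral_lborel_shift[symmetric, where u = "\<lambda>y. indicator B (f y)"]) measurable
    then show "indicator A x * (\<integral>\<^sup>+y. indicator B (f y) \<partial>lborel) =
        (\<integral>\<^sup>+y. indicator A x * indicator B (f y + x) \<partial>lborel)"
      by (simp add: linear_add[OF lin] fg nn_integral_cmult)
  qed
  also have "\<dots> = (\<integral>\<^sup>+y. (\<integral>\<^sup>+x. indicator A x * indicator B (f y + x) \<partial>lborel) \<partial>lborel)"
    by (rule lborel_pair.Fubini') measurable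
  also have "\<dots> = (\<integral>\<^sup>+y. (\<integral>\<^sup>+x. indicator A (x - f y) * indicator B x \<partial>lborel) \<partial>lborel)"
  proof (rule nn_integral_cong)
    fix y :: 'a
    show "(\<integral>\<^sup>+x. indicator A x * indicator B (f y + x) \<partial>lborel) =
        (\<integral>\<^sup>+x. indicator A (x - f y) * indicator B x \<partial>lborel)"
      using nn_integral_lborel_shift[where u = "\<lambda>x. indicator A (x - f y) * indicator B x" and c = "f y"]
      by (simp add: add.commute)
  qed
  also have "\<dots> = (\<integral>\<^sup>+x. (\<integral>\<^sup>+y. indicator A (x - f y) * indicator B x \<partial>lborel) \<partial>lborel)"
    by (rule lborel_pair.Fubini') measurable
  also have "\<dots> = emeasure lborel A * emeasure lborel B"
    by (simp add: nn_integral_multc ball nn_integral_cmult)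
  finally have "emeasure lborel A * emeasure lborel (f -` B) = emeasure lborel A * emeasure lborel B" .
  moreover have "unit_ball_vol (real DIM('a)) \<noteq> 0"
    by (rule less_imp_neq[symmetric], rule unit_ball_vol_pos) simp
  then have "emeasure lborel A \<noteq> 0" "emeasure lborel A \<noteq> top" by (auto simp: A_def emeasure_ball)
  ultimately have "emeasure lborel (f -` B) = emeasure lborel B"
    by (simp add: ennreal_mult_cancel_left)
  then show "emeasure (distr lborel borel f) B = emeasure lborel B"
    by (simp add: emeasure_distr)
qed simp

text \<open>Substituting \<open>R\<close> preserves both Lebesgue measure and the inner product in
  the exponent.\<close>

lemma fourier_orthogonal:
  fixes R :: "real^'n \<Rightarrow> real^'n" and g :: "real^'n \<Rightarrow> complex"
  assumes R: "orthogonal_transformation R" and [measurable]: "g \<in> borel_measurable borel"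
  shows "fourier (\<lambda>x. g (R x)) \<xi> = fourier g (R \<xi>)"
proof -
  note [measurable] = borel_measurable_orthogonal[OF R]
  let ?e = "\<lambda>x. exp (- 2 * complex_of_real pi * \<i> * complex_of_real (x \<bullet> R \<xi>))"
  have "fourier g (R \<xi>) = (LINT x|distr lborel borel R. g x * ?e x)"
    unfolding lborel_distr_orthogonal[OF R] fourier_def ..
  also have "\<dots> = (LINT x|lborel. g (R x) * ?e (R x))"
    by (rule integral_distr) measurable
  also have "\<dots> = fourier (\<lambda>x. g (R x)) \<xi>"
    using R by (simp add: fourier_def orthogonal_transformation_def)
  finally show ?thesis ..
qed

section \<open>Continuity and decay of Schwartz functions\<close>

lemma schwartz_continuous: "schwartz h \<Longrightarrow> continuous_on UNIV h"
  unfolding schwartz_def iter_partial_deriv_def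
  \<comment> \<open>The empty list of directions gives the condition on \<open>h\<close>
    itself.\<close>
  by (drule spec[of _ "[]"]) (auto intro: differentiable_imp_continuous_within simp: continuous_on_eq_continuous_within)

text \<open>Splitting at norm 1 gives
  \<open>(1 + r\<^sup>2) ^ m \<le> 2 ^ m * (1 + r ^ (2 * m))\<close>, which leaves only the Schwartz
  bounds with exponents 0 and \<open>2 * m\<close>.\<close>

lemma schwartz_decay:
  fixes h :: "real^'n \<Rightarrow> real"
  assumes "schwartz h"
  obtains C where "\<And>x. (1 + (norm x)\<^sup>2) ^ m * \<bar>h x\<bar> \<le> C"
proof -
  have "bounded (range (\<lambda>x. norm x ^ k *\<^sub>R h x))" for k
    using assms unfolding schwartz_def iter_partial_deriv_def by (auto dest: spec[of _ "[]"])
  then have "\<exists>B. \<forall>x. norm x ^ k * \<bar>h x\<bar> \<le> B" for k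
    unfolding bounded_iff by (auto simp: abs_mult)
  then obtain B where B: "\<And>k x. norm x ^ k * \<bar>h x\<bar> \<le> B k" by metis
  show thesis
  proof
    fix x :: "real^'n"
    have "(1 + (norm x)\<^sup>2) ^ m \<le> 2 ^ m * (1 + norm x ^ (2 * m))"
    proof (cases "norm x \<le> 1")
      case True
      then have "(norm x)\<^sup>2 \<le> 1" by (simp add: power_le_one)
      then have "(1 + (norm x)\<^sup>2) ^ m \<le> 2 ^ m" by (intro power_mono) auto
      also have "\<dots> \<le> 2 ^ m * (1 + norm x ^ (2 * m))" by simp
      finally show ?thesis .
    next
      case False
      then have "1 \<le> (norm x)\<^sup>2" by (simp add: one_le_power)
      then have "(1 + (norm x)\<^sup>2) ^ m \<le> (2 * (norm x)\<^sup>2) ^ m" by (intro power_mono) auto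
      also have "\<dots> \<le> 2 ^ m * (1 + norm x ^ (2 * m))"
        by (simp add: power_mult_distrib power_mult[symmetric])
      finally show ?thesis .
    qed
    then have "(1 + (norm x)\<^sup>2) ^ m * \<bar>h x\<bar> \<le> 2 ^ m * (1 + norm x ^ (2 * m)) * \<bar>h x\<bar>"
      by (rule mult_right_mono) simp
    also have "\<dots> = 2 ^ m * (norm x ^ 0 * \<bar>h x\<bar> + norm x ^ (2 * m) * \<bar>h x\<bar>)"
      by (simp add: algebra_simps)
    also have "\<dots> \<le> 2 ^ m * (B 0 + B (2 * m))"
      by (intro mult_left_mono add_mono B) auto
    finally show "(1 + (norm x)\<^sup>2) ^ m * \<bar>h x\<bar> \<le> 2 ^ m * (B 0 + B (2 * m))" .
  qed
qed

lemma inverse_norm_power_le_cauchy_weight: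
  fixes x :: "real^'n"
  shows "1 / (1 + (norm x)\<^sup>2) ^ CARD('n) \<le> cauchy_weight x"
proof -
  have "1 / (1 + (norm x)\<^sup>2) \<le> 1 / (1 + (x $ i)\<^sup>2)" for i
    using power_mono[OF component_le_norm_cart[of x i], of 2] one_plus_square_pos[of "x $ i"]
    by (intro divide_left_mono) (auto simp: add_pos_nonneg)
  then have "(\<Prod>i\<in>(UNIV::'n set). 1 / (1 + (norm x)\<^sup>2)) \<le> cauchy_weight x"
    unfolding cauchy_weight_def by (intro prod_mono) (auto simp: less_imp_le[OF one_plus_square_pos])
  then show ?thesis by (simp add: power_one_over)
qed

text \<open>The decay is first expressed through the norm, which \<open>R\<close> preserves, and
  only then compared with the product weight, which need not be invariant under
  \<open>R\<close>.\<close>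

lemma dominated_schwartz_orthogonal:
  fixes h :: "real^'n \<Rightarrow> real" and R :: "real^'n \<Rightarrow> real^'n"
  assumes h: "schwartz h" and R: "orthogonal_transformation R"
  obtains C where "dominated_function (\<lambda>x. h (R x)) C"
proof -
  obtain C where C: "\<And>x. (1 + (norm x)\<^sup>2) ^ CARD('n) * \<bar>h x\<bar> \<le> C"
    using schwartz_decay[OF h] by blast
  have C0: "0 \<le> C" using C[of 0] by auto
  have "dominated_function (\<lambda>x. h (R x)) C"
  proof
    show "continuous_on UNIV (\<lambda>x. h (R x))"
      using orthogonal_transformation_linear[OF R]
      by (intro continuous_on_compose2[OF schwartz_continuous[OF h]] linear_continuous_on)
         (auto simp: linear_conv_bounded_linear)
    fix x :: "real^'n"
    have pos: "0 < (1 + (norm x)\<^sup>2) ^ CARD('n)" by (simp add: one_plus_square_pos)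
    have "\<bar>h (R x)\<bar> \<le> C * (1 / (1 + (norm x)\<^sup>2) ^ CARD('n))"
      using C[of "R x"] pos by (simp add: orthogonal_transformation_norm[OF R] field_simps)
    also have "\<dots> \<le> C * cauchy_weight x"
      by (intro mult_left_mono inverse_norm_power_le_cauchy_weight C0)
    finally show "\<bar>h (R x)\<bar> \<le> C * cauchy_weight x" .
  qed
  then show thesis using that by blast
qed


section \<open>Rotated integer lattices\<close>

text \<open>Makes the two sign conditions available on the rotated lattice: the basis matrix has
  determinant 1 or -1, and \<open>R\<close> preserves the integral inner products.\<close>

lemma orthogonal_image_Zn:
  fixes R :: "real^'n \<Rightarrow> real^'n"
  assumes R: "orthogonal_transformation R"
  shows "unimodular_lattice (R ` Zn)" "integral_lattice (R ` Zn)"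
proof -
  have "orthogonal_matrix (matrix R)"
    using R by (simp add: orthogonal_transformation_matrix)
  then have det: "\<bar>det (matrix R)\<bar> = 1"
    using det_orthogonal_matrix[of "matrix R"] by auto
  then have inv: "invertible (matrix R)" by (auto simp: invertible_det_nz)
  have eq: "R ` Zn = lattice_of (matrix R)"
    using orthogonal_transformation_linear[OF R] by (simp add: lattice_of_def)
  have full: "full_lattice (R ` Zn)" unfolding full_lattice_def using inv eq by blast
  show "unimodular_lattice (R ` Zn)"
    using full covol_lattice_of[OF inv] det by (simp add: unimodular_lattice_def eq)
  have "x \<bullet> y \<in> \<int>" if "x \<in> Zn" "y \<in> Zn" for x y :: "real^'n"
    using that unfolding inner_vec_def by (intro Ints_sum) (auto simp: Zn_def)
  then show "integral_lattice (R ` Zn)"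
    using full R by (auto simp: integral_lattice_def orthogonal_transformation_def)
qed

text \<open>The four squares are placed on four distinct coordinates, which is where the dimension
  bound enters.\<close>

lemma exists_Zn_norm_square:
  assumes n: "CARD('n) \<ge> 4"
  obtains z :: "real^'n" where "z \<in> Zn" "(norm z)\<^sup>2 = real m"
proof -
  obtain a b c d :: int where abcd: "int m = a\<^sup>2 + b\<^sup>2 + c\<^sup>2 + d\<^sup>2"
    using sum_of_4_squares_nat[of m] unfolding sum_of_4_squares_def by blast
  obtain S :: "'n set" where S: "card S = 4" using obtain_subset_with_card_n[OF n] by blast
  obtain xs where xs: "set xs = S" "distinct xs" using finite_distinct_list[of S] by auto
  then have "length xs = 4" using S distinct_card[of xs] by simp
  then obtain i j k l where "xs = [i, j, k, l]" by (auto simp: numeral_eq_Suc length_Suc_conv)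
  then have ne: "i \<noteq> j" "j \<noteq> i" "i \<noteq> k" "k \<noteq> i" "i \<noteq> l" "l \<noteq> i"
      "j \<noteq> k" "k \<noteq> j" "j \<noteq> l" "l \<noteq> j" "k \<noteq> l" "l \<noteq> k"
    using xs(2) by auto
  define z :: "real^'n" where "z = axis i (of_int a) + axis j (of_int b) + axis k (of_int c) + axis l (of_int d)"
  show thesis
  proof
    show "z \<in> Zn" by (auto simp: z_def Zn_def axis_def)
    have "(norm z)\<^sup>2 = of_int (a\<^sup>2 + b\<^sup>2 + c\<^sup>2 + d\<^sup>2)"
      unfolding power2_norm_eq_inner z_def
      by (simp add: ne inner_add_left inner_add_right inner_axis_axis power2_eq_square)
    then show "(norm z)\<^sup>2 = real m" unfolding abcd[symmetric] by simp
  qed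
qed

section \<open>The equality case on one rotated lattice\<close>

theorem theorem1p1:
  fixes h :: "real ^ 'n \<Rightarrow> real" and t :: real
  assumes n: "CARD('n) \<ge> 4"
    and t: "t > 0"
    and schwartz: "schwartz h"
    and even: "\<And>x. h (- x) = h x"
    and ge_gaussian: "\<And>L x. unimodular_lattice L \<Longrightarrow> integral_lattice L \<Longrightarrow> x \<in> L \<Longrightarrow> x \<noteq> 0 \<Longrightarrow>
      h x \<ge> exp (- t * (norm x)\<^sup>2)"
    and fourier_le: "\<And>L x. unimodular_lattice L \<Longrightarrow> integral_lattice L \<Longrightarrow> x \<in> L \<Longrightarrow> x \<noteq> 0 \<Longrightarrow>
      Re (fourier (\<lambda>y. complex_of_real (h y)) x) \<le> 0"
    and sharp: "1 + Re (fourier (\<lambda>y. complex_of_real (h y)) 0) - h 0 = gaussian_mass (Zn :: (real ^ 'n) set) t"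
  shows "\<forall>x :: real ^ 'n. x \<noteq> 0 \<and> (norm x)\<^sup>2 \<in> \<int> \<longrightarrow>
    h x = exp (- t * (norm x)\<^sup>2) \<and> fourier (\<lambda>y. complex_of_real (h y)) x = 0"
proof (intro allI impI)
  fix x :: "real^'n" assume x: "x \<noteq> 0 \<and> (norm x)\<^sup>2 \<in> \<int>"
  then have "(norm x)\<^sup>2 \<in> \<nat>" by (simp add: Nats_altdef2)
  then obtain m where m: "(norm x)\<^sup>2 = real m" by (elim Nats_cases)
  obtain z :: "real^'n" where z: "z \<in> Zn" "(norm z)\<^sup>2 = real m"
    using exists_Zn_norm_square[OF n] by blast
  have "norm z = norm x" using z(2) m by (metis norm_ge_zero power2_eq_imp_eq)
  then obtain R where R: "orthogonal_transformation R" "R z = x"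
    using orthogonal_transformation_exists by blast
  have z0: "z \<noteq> 0" using x \<open>norm z = norm x\<close> by auto
  have R0: "R 0 = 0" using R(1) by (simp add: linear_0 orthogonal_transformation_linear)
  have Rnz: "R k \<noteq> 0" if "k \<noteq> 0" for k
    using that orthogonal_transformation_norm[OF R(1), of k] by auto
  define f where "f k = h (R k)" for k
  define F where "F k = Re (fourier (\<lambda>y. complex_of_real (f y)) k)" for k
  define G where "G k = exp (- t * (norm k)\<^sup>2)" for k :: "real^'n"
  let ?S = "Zn - {0} :: (real^'n) set"
  have [measurable]: "h \<in> borel_measurable borel"
    by (rule borel_measurable_continuous_onI[OF schwartz_continuous[OF schwartz]])
  have four: "fourier (\<lambda>y. complex_of_real (f y)) k = fourier (\<lambda>y. complex_of_real (h y)) (R k)" for k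
    unfolding f_def by (rule fourier_orthogonal[OF R(1)]) measurable
  obtain C where "dominated_function f C"
    using dominated_schwartz_orthogonal[OF schwartz R(1)] unfolding f_def by blast
  then interpret dominated_function f C .
  have F_le: "F k \<le> 0" if "k \<in> Zn" "k \<noteq> 0" for k
    unfolding F_def four using that Rnz orthogonal_image_Zn[OF R(1)] fourier_le by blast
  have f_ge: "G k \<le> f k" if "k \<in> ?S" for k
    using ge_gaussian[OF orthogonal_image_Zn[OF R(1)], of "R k"] that Rnz[of k]
      orthogonal_transformation_norm[OF R(1), of k] by (simp add: f_def G_def)
  have Z: "Zn = insert 0 ?S" by (auto simp: Zn_def)
  have fS: "f summable_on ?S" by (intro summable_on_cofin_subset fejer_summation) auto
  \<comment> \<open>The Gaussian is summable because it lies below the summable \<open>f\<close> on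
    nonzero lattice points.\<close>
  then have GS: "G summable_on ?S"
    by (rule summable_on_comparison_test[OF _ f_ge]) (simp_all add: G_def)
  have "infsum f Zn = f 0 + infsum f ?S" by (subst Z, rule infsum_insert[OF fS]) simp
  moreover have "infsum f Zn \<le> F 0 + F z"
    unfolding F_def by (rule infsum_le_fourier[OF _ z(1) z0]) (use F_le in \<open>simp add: F_def\<close>)
  moreover have "infsum G Zn = G 0 + infsum G ?S" by (subst Z, rule infsum_insert[OF GS]) simp
  moreover have "infsum G Zn = 1 + F 0 - f 0"
    using sharp four[of 0] by (simp add: gaussian_mass_def G_def[abs_def] F_def R0) (simp add: f_def R0)
  moreover have "infsum G ?S \<le> infsum f ?S" by (intro infsum_mono GS fS f_ge)
  moreover have "F z \<le> 0" by (rule F_le[OF z(1) z0])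
  \<comment> \<open>As \<open>G 0 = 1\<close>, sharpness reads
    \<open>infsum G ?S = F 0 - f 0\<close>, so the summation bound becomes
    \<open>infsum f ?S \<le> infsum G ?S + F z\<close>. Together with
    \<open>infsum G ?S \<le> infsum f ?S\<close> and \<open>F z \<le> 0\<close> this leaves only
    equality.\<close>
  ultimately have Fz: "F z = 0" and eq: "infsum f ?S = infsum G ?S"
    by (simp_all add: G_def)
  have "((\<lambda>k. f k + - G k) has_sum (infsum f ?S + - infsum G ?S)) ?S"
    by (intro has_sum_add has_sum_infsum fS) (simp add: has_sum_uminus GS)
  then have "(\<lambda>k. f k - G k) summable_on ?S" "infsum (\<lambda>k. f k - G k) ?S = 0"
    unfolding eq by (auto dest: has_sum_imp_summable infsumI)
  \<comment> \<open>A sum of nonnegative terms equal to 0 has only zero terms.\<close>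
  then have "f z - G z = 0"
    by (intro nonneg_infsum_le_0D[of "\<lambda>k. f k - G k" ?S z]) (use f_ge z z0 in auto)
  then have "h x = exp (- t * (norm x)\<^sup>2)"
    using R(2) \<open>norm z = norm x\<close> by (simp add: f_def G_def)
  \<comment> \<open>\<open>F z = 0\<close> concerns only the real part; the imaginary part vanishes
    because \<open>h\<close> is even.\<close>
  moreover have "fourier (\<lambda>y. complex_of_real (h y)) x = 0"
    using Fz fourier_even_real[of h x] even R(2)
    by (simp add: F_def four complex_is_Real_iff complex_eq_iff)
  ultimately show "h x = exp (- t * (norm x)\<^sup>2) \<and> fourier (\<lambda>y. complex_of_real (h y)) x = 0" ..
qed

end
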